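(* Let $X$ be a real Banach space such that $X^*$ and $X^{**}$ are strictly convex, $X$ has the w-Kadec-Klee property and $X^*$ has the $w^*$-Kadec-Klee property. Let $A:X\rightrightarrows X^*$ be a maximal monotone operator of type (D). Then for every $x\in D(A)$ and $v\in X\setminus\{0\}$, $$\sigma_{Ax}(v)=\liminf_{t\downarrow0,\ w\to v}\langle A^\circ(x+tw),w\rangle,$$ with the convention $\langle A^\circ(x+tw),w\rangle=+\infty$ if $x+tw\notin D(A)$.
   Context: $\sigma_{Ax}(v)=\sup_{x^*\in Ax}\langle x^*,v\rangle$. $A^\circ y$ is the unique element of minimal norm in $Ay$ (unique since $X^*$ is strictly convex). The liminf means $\lim_{\delta\downarrow0}\inf\{\langle A^\circ(x+tw),w\rangle: 0<t<\delta,\ \|w-v\|<\delta\}$. Type (D): for every $(x^{**},x^* )\in X^{**}\times X^*$ with $\langle x^*-y^*,x^{**}-y\rangle\ge0$ for all $(y,y^* )\in Gr(A)$ there is a bounded net $(x_i,x_i^* )$ in $Gr(A)$ with $x_i\to x^{**}$ in $\tau(X^{**},X^* )$ and $x_i^*\to x^*$ in norm. $X$ has the w-Kadec-Klee property if every net with $x_i\to x$ weakly and $\|x_i\|\to\|x\|$ converges in norm; $X^*$ has the $w^*$-Kadec-Klee property if every net with $x_i^*\to x^*$ weak$^*$ and $\|x_i^*\|\to\|x^*\|$ converges in norm. *)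

theory Defs
  imports "HOL-Analysis.Analysis"
begin

(* X is a type 'a::banach, X* = 'a <Rightarrow><^sub>L real, X** = ('a <Rightarrow><^sub>L real) <Rightarrow><^sub>L real.
  Set-valued operators A : X <rightrightarrows> X* are functions 'a <Rightarrow> ('a <Rightarrow><^sub>L real) set.
  Nets are represented by filters (a net x_i converges iff its image filter does). *)

definition strictly_convex :: "'b::real_normed_vector itself \<Rightarrow> bool" where
  "strictly_convex _ \<longleftrightarrow>
     (\<forall>x y :: 'b. norm x = 1 \<and> norm y = 1 \<and> x \<noteq> y \<longrightarrow> norm ((1/2) *\<^sub>R (x + y)) < 1)"

definition w_Kadec_Klee :: "'a::real_normed_vector itself \<Rightarrow> bool" where
  "w_Kadec_Klee _ \<longleftrightarrow>
     (\<forall>(F :: 'a filter) (x :: 'a).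
        (\<forall>f :: 'a \<Rightarrow>\<^sub>L real. ((\<lambda>y. blinfun_apply f y) \<longlongrightarrow> blinfun_apply f x) F)
        \<and> ((\<lambda>y. norm y) \<longlongrightarrow> norm x) F
        \<longrightarrow> ((\<lambda>y. y) \<longlongrightarrow> x) F)"

definition wstar_Kadec_Klee :: "'a::real_normed_vector itself \<Rightarrow> bool" where
  "wstar_Kadec_Klee _ \<longleftrightarrow>
     (\<forall>(F :: ('a \<Rightarrow>\<^sub>L real) filter) (f :: 'a \<Rightarrow>\<^sub>L real).
        (\<forall>x :: 'a. ((\<lambda>g. blinfun_apply g x) \<longlongrightarrow> blinfun_apply f x) F)
        \<and> ((\<lambda>g. norm g) \<longlongrightarrow> norm f) F
        \<longrightarrow> ((\<lambda>g. g) \<longlongrightarrow> f) F)"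

definition graph :: "('a \<Rightarrow> 'b set) \<Rightarrow> ('a \<times> 'b) set" where
  "graph A = {(x, x'). x' \<in> A x}"

definition dom_op :: "('a \<Rightarrow> 'b set) \<Rightarrow> 'a set" where
  "dom_op A = {x. A x \<noteq> {}}"

definition monotone_op :: "('a::real_normed_vector \<Rightarrow> ('a \<Rightarrow>\<^sub>L real) set) \<Rightarrow> bool" where
  "monotone_op A \<longleftrightarrow>
     (\<forall>(x, x') \<in> graph A. \<forall>(y, y') \<in> graph A. blinfun_apply (x' - y') (x - y) \<ge> 0)"

definition maximal_monotone :: "('a::real_normed_vector \<Rightarrow> ('a \<Rightarrow>\<^sub>L real) set) \<Rightarrow> bool" where
  "maximal_monotone A \<longleftrightarrow> monotone_op A \<and>
     (\<forall>x x'. (\<forall>(y, y') \<in> graph A. blinfun_apply (x' - y') (x - y) \<ge> 0) \<longrightarrow> x' \<in> A x)"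

(* Type (D): the bidual is paired with X* via evaluation; X embeds canonically.
  Convergence x_i <rightarrow> x** in the topology of pointwise convergence on X* (weak-star),
  x_i* <rightarrow> x* in norm; the net lies in Gr(A) and is bounded (eventually, w.l.o.g.). *)
definition type_D :: "('a::real_normed_vector \<Rightarrow> ('a \<Rightarrow>\<^sub>L real) set) \<Rightarrow> bool" where
  "type_D A \<longleftrightarrow>
     (\<forall>(xx :: ('a \<Rightarrow>\<^sub>L real) \<Rightarrow>\<^sub>L real) (x' :: 'a \<Rightarrow>\<^sub>L real).
        (\<forall>(y, y') \<in> graph A. blinfun_apply xx (x' - y') - blinfun_apply (x' - y') y \<ge> 0)
        \<longrightarrow> (\<exists>F :: ('a \<times> ('a \<Rightarrow>\<^sub>L real)) filter. F \<noteq> bot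
              \<and> eventually (\<lambda>p. p \<in> graph A) F
              \<and> (\<exists>B. eventually (\<lambda>p. norm (fst p) \<le> B \<and> norm (snd p) \<le> B) F)
              \<and> (\<forall>f :: 'a \<Rightarrow>\<^sub>L real.
                   ((\<lambda>p. blinfun_apply f (fst p)) \<longlongrightarrow> blinfun_apply xx f) F)
              \<and> ((\<lambda>p. snd p) \<longlongrightarrow> x') F))"

definition min_norm_sel :: "('a \<Rightarrow> ('b::real_normed_vector) set) \<Rightarrow> 'a \<Rightarrow> 'b" where
  "min_norm_sel A y = (THE z. z \<in> A y \<and> (\<forall>w \<in> A y. norm z \<le> norm w))"

definition support_fun :: "('a::real_normed_vector \<Rightarrow>\<^sub>L real) set \<Rightarrow> 'a \<Rightarrow> ereal" where
  "support_fun S v = (SUP f \<in> S. ereal (blinfun_apply f v))"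

definition dir_val :: "('a::real_normed_vector \<Rightarrow> ('a \<Rightarrow>\<^sub>L real) set) \<Rightarrow> 'a \<Rightarrow> real \<Rightarrow> 'a \<Rightarrow> ereal" where
  "dir_val A x t w =
     (if x + t *\<^sub>R w \<in> dom_op A then ereal (blinfun_apply (min_norm_sel A (x + t *\<^sub>R w)) w)
      else \<infinity>)"

end

theory Submission
  imports Defs
begin

text \<open>
  The inequality \<open>\<le>\<close> is monotonicity along the segment from \<open>x\<close>. For \<open>\<ge>\<close> let \<open>\<sigma>(v) < \<infinity>\<close>, put
  \<open>z = x + t v\<close> and solve \<open>0 \<in> \<alpha> t A y + J (y - z)\<close> up to a small error. With \<open>w = (y - x) / t\<close> and
  \<open>y' \<in> A y\<close>, monotonicity against an almost maximising element of \<open>A x\<close> bounds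
  \<open>\<alpha> |y'|^2 + |w - v|^2 / \<alpha>\<close> by \<open>\<langle>y', v\<rangle> - \<sigma>(v)\<close> plus small terms, and for fixed \<open>\<alpha>\<close> the upper limit of
  \<open>\<langle>y', v\<rangle>\<close> as \<open>t \<rightarrow> 0\<close> is at most \<open>\<sigma>(v)\<close> by weak-star compactness. So \<open>|w - v|\<close> and
  \<open>|y'| |w - v|\<close> are small, and \<open>\<langle>A\<degree> y, w\<rangle> \<le> \<langle>A\<degree> y, v\<rangle> + |y'| |w - v|\<close> is at most \<open>\<sigma>(v)\<close> in the limit.

  The approximate solutions come from type (D) through the negative infimum condition: Fenchel
  duality gives points of the convex hull that solve the inclusion approximately and lie in an
  enlargement of the graph, and a Bronsted--Rockafellar iteration moves them into the graph.
\<close>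

subsection \<open>Hahn--Banach and a convex sandwich theorem\<close>

definition sublinear :: "('b::real_vector \<Rightarrow> real) \<Rightarrow> bool" where
  "sublinear p \<longleftrightarrow> (\<forall>x y. p (x + y) \<le> p x + p y) \<and> (\<forall>c>0. \<forall>x. p (c *\<^sub>R x) \<le> c * p x)"

lemma sublinear_add: "sublinear p \<Longrightarrow> p (x + y) \<le> p x + p y"
  by (simp add: sublinear_def)

lemma sublinear_scaleR:
  assumes "sublinear p" "c > 0"
  shows "p (c *\<^sub>R x) = c * p x"
proof (rule antisym)
  show "p (c *\<^sub>R x) \<le> c * p x"
    using assms by (simp add: sublinear_def)
  have "p ((1 / c) *\<^sub>R (c *\<^sub>R x)) \<le> (1 / c) * p (c *\<^sub>R x)"
    using assms unfolding sublinear_def by (meson zero_less_divide_1_iff)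
  then show "c * p x \<le> p (c *\<^sub>R x)"
    using assms by (simp add: field_simps)
qed

lemma sublinear_0: "sublinear p \<Longrightarrow> p 0 = 0"
  using sublinear_scaleR[of p 2 0] by simp

lemma sublinear_uminus:
  assumes "sublinear p"
  shows "- p (- x) \<le> p x"
  using sublinear_add[OF assms, of x "- x"] sublinear_0[OF assms] by simp

text \<open>Every member lies above \<open>- q (- x)\<close>, so the infimum is real. Subadditivity
  uses the chain: of two members the smaller one bounds the values at both points.\<close>

lemma sublinear_INF_chain:
  fixes C :: "('b::real_vector \<Rightarrow> real) set"
  assumes "C \<noteq> {}" and sub: "\<And>p. p \<in> C \<Longrightarrow> sublinear p" and le: "\<And>p. p \<in> C \<Longrightarrow> p \<le> q"
    and chain: "\<And>p r. p \<in> C \<Longrightarrow> r \<in> C \<Longrightarrow> p \<le> r \<or> r \<le> p"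
  shows "sublinear (\<lambda>x. INF p\<in>C. p x)" and "\<And>p. p \<in> C \<Longrightarrow> (\<lambda>x. INF p\<in>C. p x) \<le> p"
proof -
  define u where "u = (\<lambda>x. INF p\<in>C. p x)"
  have bdd: "bdd_below ((\<lambda>p. p x) ` C)" for x
  proof (intro bdd_belowI2)
    fix p assume "p \<in> C"
    then show "- q (- x) \<le> p x"
      using sublinear_uminus[OF sub, of p x] le_funD[OF le, of p "- x"] by linarith
  qed
  have lower: "u x \<le> p x" if "p \<in> C" for p x
    unfolding u_def using bdd that by (rule cINF_lower)
  show "\<And>p. p \<in> C \<Longrightarrow> (\<lambda>x. INF p\<in>C. p x) \<le> p"
    using lower by (simp add: u_def le_fun_def)
  have "u (x + y) \<le> u x + u y" for x y
  proof -
    have *: "u (x + y) \<le> p x + r y" if pr: "p \<in> C" "r \<in> C" for p r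
    proof -
      obtain s where s: "s \<in> C" "s \<le> p" "s \<le> r"
        using chain[OF pr] pr by blast
      show ?thesis
        using lower[OF s(1), of "x + y"] sublinear_add[OF sub[OF s(1)], of x y]
          le_funD[OF s(2), of x] le_funD[OF s(3), of y] by linarith
    qed
    have "u (x + y) - r y \<le> u x" if "r \<in> C" for r
      unfolding u_def using assms(1) * that
      by (intro cINF_greatest) (auto simp: u_def algebra_simps)
    then have "u (x + y) - u x \<le> r y" if "r \<in> C" for r
      using that by (auto simp: algebra_simps)
    then have "u (x + y) - u x \<le> u y"
      unfolding u_def using assms(1) by (intro cINF_greatest) auto
    then show ?thesis by simp
  qed
  moreover have "u (c *\<^sub>R x) \<le> c * u x" if "c > 0" for c x
  proof -
    have "u (c *\<^sub>R x) / c \<le> p x" if "p \<in> C" for p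
      using lower[OF that, of "c *\<^sub>R x"] sublinear_scaleR[OF sub[OF that] \<open>c > 0\<close>] \<open>c > 0\<close>
      by (simp add: field_simps)
    then have "u (c *\<^sub>R x) / c \<le> u x"
      unfolding u_def using assms(1) by (intro cINF_greatest) auto
    then show ?thesis using that by (simp add: field_simps)
  qed
  ultimately show "sublinear (\<lambda>x. INF p\<in>C. p x)"
    unfolding sublinear_def u_def by blast
qed

text \<open>The minorant \<open>d y\<close> serves the minimality argument: if \<open>p\<close> is
  minimal then \<open>d y = p\<close>, and the third claim, the term \<open>t = 1\<close> of the
  infimum, becomes superadditivity.\<close>

lemma sublinear_directional:
  assumes p: "sublinear p"
  defines "d \<equiv> \<lambda>y x. INF t\<in>{0..}. p (x + t *\<^sub>R y) - t * p y"
  shows "sublinear (d y)" and "d y \<le> p" and "d y x \<le> p (x + y) - p y"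
proof -
  have scale: "p (t *\<^sub>R y) = t * p y" if "t \<ge> 0" for t
    using that sublinear_scaleR[OF p] sublinear_0[OF p] by (cases "t = 0") auto
  have bdd: "bdd_below ((\<lambda>t. p (x + t *\<^sub>R y) - t * p y) ` {0..})" for x
  proof (intro bdd_belowI2)
    fix t :: real assume "t \<in> {0..}"
    then show "- p (- x) \<le> p (x + t *\<^sub>R y) - t * p y"
      using sublinear_add[OF p, of "x + t *\<^sub>R y" "- x"] scale[of t] by simp
  qed
  have lower: "d y x \<le> p (x + t *\<^sub>R y) - t * p y" if "t \<ge> 0" for t x
    unfolding d_def using bdd that by (intro cINF_lower) auto
  show "d y x \<le> p (x + y) - p y"
    using lower[of 1 x] by simp
  show "d y \<le> p"
    using lower[of 0] by (simp add: le_fun_def)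
  have ge: "b \<le> d y x" if "\<And>t. t \<ge> 0 \<Longrightarrow> b \<le> p (x + t *\<^sub>R y) - t * p y" for b x
    unfolding d_def using that by (intro cINF_greatest) auto
  have "d y (x + x') \<le> d y x + d y x'" for x x'
  proof -
    have *: "d y (x + x') \<le> (p (x + t *\<^sub>R y) - t * p y) + (p (x' + t' *\<^sub>R y) - t' * p y)"
      if "t \<ge> 0" "t' \<ge> 0" for t t'
      using lower[of "t + t'" "x + x'"] sublinear_add[OF p, of "x + t *\<^sub>R y" "x' + t' *\<^sub>R y"] that
      by (simp add: algebra_simps)
    have "d y (x + x') - (p (x' + t' *\<^sub>R y) - t' * p y) \<le> d y x" if "t' \<ge> 0" for t'
      using *[OF _ that] by (intro ge) (auto simp: algebra_simps)
    then have "d y (x + x') - d y x \<le> d y x'"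
      by (intro ge) (auto simp: algebra_simps)
    then show ?thesis by simp
  qed
  moreover have "d y (c *\<^sub>R x) \<le> c * d y x" if "c > 0" for c x
  proof -
    have "d y (c *\<^sub>R x) / c \<le> d y x"
    proof (rule ge)
      fix t :: real assume "t \<ge> 0"
      have "p (c *\<^sub>R x + (c * t) *\<^sub>R y) = c * p (x + t *\<^sub>R y)"
        using sublinear_scaleR[OF p \<open>c > 0\<close>, of "x + t *\<^sub>R y"] by (simp add: algebra_simps)
      then show "d y (c *\<^sub>R x) / c \<le> p (x + t *\<^sub>R y) - t * p y"
        using lower[of "c * t" "c *\<^sub>R x"] \<open>c > 0\<close> \<open>t \<ge> 0\<close>
        by (simp add: field_simps)
    qed
    then show ?thesis using that by (simp add: field_simps)
  qed
  ultimately show "sublinear (d y)"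
    unfolding sublinear_def by blast
qed

text \<open>A pointwise minimal sublinear functional \<open>m\<close> is linear: minimality forces
  \<open>m x \<le> m (x + y) - m y\<close>.\<close>

theorem Hahn_Banach_sublinear:
  fixes q :: "'b::real_vector \<Rightarrow> real"
  assumes q: "sublinear q"
  obtains L where "linear L" "\<And>x. L x \<le> q x"
proof -
  define S where "S = {p. sublinear p \<and> p \<le> q}"
  have "\<exists>m\<in>S. \<forall>a\<in>S. a \<le> m \<longrightarrow> a = m"
  proof (rule predicate_Zorn)
    show "partial_order_on S (relation_of (\<lambda>x y. y \<le> x) S)"
      by (rule partial_order_on_relation_ofI) auto
    fix C assume C: "C \<in> Chains (relation_of (\<lambda>x y. y \<le> x) S)"
    then have CS: "C \<subseteq> S" and chain: "p \<le> r \<or> r \<le> p" if "p \<in> C" "r \<in> C" for p r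
      using that unfolding Chains_def relation_of_def by auto
    show "\<exists>u\<in>S. \<forall>a\<in>C. u \<le> a"
    proof (cases "C = {}")
      case True
      then show ?thesis using q unfolding S_def by auto
    next
      case False
      have C': "p \<in> C \<Longrightarrow> sublinear p" "p \<in> C \<Longrightarrow> p \<le> q" for p
        using CS chain[of p] C unfolding Chains_def relation_of_def S_def by auto
      note INF = sublinear_INF_chain[of C q, OF False C' chain]
      obtain p where "p \<in> C" using False by blast
      then have "(\<lambda>x. INF p\<in>C. p x) \<in> S"
        using INF(1) order_trans[OF INF(2) C'(2)] unfolding S_def by blast
      then show ?thesis using INF(2) by blast
    qed
  qed
  then obtain m where m: "sublinear m" "m \<le> q"
    and min: "\<And>p. sublinear p \<Longrightarrow> p \<le> m \<Longrightarrow> p = m"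
    unfolding S_def by (auto intro: order_trans)
  have add: "m (x + y) = m x + m y" for x y
    using sublinear_directional(3)[where p = m and x = x and y = y, OF m(1)]
      sublinear_add[OF m(1), of x y]
      fun_cong[OF min[OF sublinear_directional(1,2)[where p = m and y = y, OF m(1)]], of x]
    by simp
  have uminus: "m (- x) = - m x" for x
    using add[of x "- x"] sublinear_0[OF m(1)] by simp
  have "m (c *\<^sub>R x) = c * m x" for c x
  proof (cases c "0::real" rule: linorder_cases)
    case less
    then show ?thesis
      using sublinear_scaleR[OF m(1), of "- c" x] uminus[of "c *\<^sub>R x"] by simp
  qed (use sublinear_scaleR[OF m(1)] sublinear_0[OF m(1)] in auto)
  then have "linear m"
    using add by (intro linearI) auto
  then show thesis
    using that m(2) by (auto simp: le_fun_def)
qed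

text \<open>The sublinear \<open>q\<close> below is the positively homogeneous envelope of the
  functions sending \<open>z\<close> to \<open>g (z + c) + s - e\<close>. Hahn--Banach puts a linear
  \<open>L\<close> under it, and \<open>L (u - c) \<le> q (u - c)\<close> at scale
  \<open>l = 1\<close> is the claim.\<close>

lemma convex_sandwich:
  fixes K :: "('b::real_vector \<times> real) set" and g :: "'b \<Rightarrow> real"
  assumes K: "convex K" "K \<noteq> {}" and g: "convex_on UNIV g"
    and ge: "\<And>c s. (c, s) \<in> K \<Longrightarrow> e \<le> s + g c"
  shows "\<exists>L. linear L \<and> (\<forall>u c s. (c, s) \<in> K \<longrightarrow> e + L u - L c \<le> s + g u)"
proof -
  define h where "h = (\<lambda>z l c s. l * (g ((1 / l) *\<^sub>R z + c) + s - e))"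
  \<comment> \<open>The scales add and the points of \<open>K\<close> are averaged with weights
    proportional to \<open>l\<close> and \<open>l'\<close>; this is the joint convexity of the
    perspective of \<open>g\<close>.\<close>
  have comb: "\<exists>c'' s''. (c'', s'') \<in> K \<and> h (z + z') (l + l') c'' s'' \<le> h z l c s + h z' l' c' s'"
    if K': "(c, s) \<in> K" "(c', s') \<in> K" and l: "l > 0" "l' > 0" for z z' l l' c s c' s'
  proof -
    define a b where "a = l / (l + l')" and "b = l' / (l + l')"
    have ab: "a \<ge> 0" "b \<ge> 0" "a + b = 1" and la: "(l + l') * a = l" "(l + l') * b = l'"
      using l by (auto simp: a_def b_def simp flip: add_divide_distrib)
    have inK: "(a *\<^sub>R c + b *\<^sub>R c', a * s + b * s') \<in> K"
      using convexD[OF K(1) K' ab] by simp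
    have "(1 / (l + l')) *\<^sub>R (z + z') + (a *\<^sub>R c + b *\<^sub>R c')
        = a *\<^sub>R ((1 / l) *\<^sub>R z + c) + b *\<^sub>R ((1 / l') *\<^sub>R z' + c')"
      using l by (simp add: a_def b_def algebra_simps)
    then have "g ((1 / (l + l')) *\<^sub>R (z + z') + (a *\<^sub>R c + b *\<^sub>R c'))
        \<le> a * g ((1 / l) *\<^sub>R z + c) + b * g ((1 / l') *\<^sub>R z' + c')"
      using g ab by (auto simp: convex_on_def)
    then have "g ((1 / (l + l')) *\<^sub>R (z + z') + (a *\<^sub>R c + b *\<^sub>R c')) + (a * s + b * s') - e
        \<le> a * (g ((1 / l) *\<^sub>R z + c) + s - e) + b * (g ((1 / l') *\<^sub>R z' + c') + s' - e)"
      using ab(3) by (simp add: algebra_simps flip: distrib_right[of a b e])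
    then have "h (z + z') (l + l') (a *\<^sub>R c + b *\<^sub>R c') (a * s + b * s')
        \<le> (l + l') * (a * (g ((1 / l) *\<^sub>R z + c) + s - e) + b * (g ((1 / l') *\<^sub>R z' + c') + s' - e))"
      unfolding h_def using l by (intro mult_left_mono) auto
    also have "\<dots> = h z l c s + h z' l' c' s'"
      unfolding h_def distrib_left mult.assoc[symmetric] la ..
    finally show ?thesis using inK by blast
  qed
  have h0: "h 0 l c s \<ge> 0" if "(c, s) \<in> K" "l > 0" for l c s
    using ge[OF that(1)] that(2) by (simp add: h_def)
  define P where "P = {0::real<..} \<times> K"
  define q where "q = (\<lambda>z. INF (l, c, s)\<in>P. h z l c s)"
  obtain c0 s0 where c0: "(c0, s0) \<in> K" using K(2) by auto
  have P: "P \<noteq> {}" using c0 unfolding P_def by fastforce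
  have bdd: "bdd_below ((\<lambda>(l, c, s). h z l c s) ` P)" for z
  proof (intro bdd_belowI2[where m = "- h (- z) 1 c0 s0"])
    fix x assume "x \<in> P"
    then obtain l c s where x: "x = (l, c, s)" "l > 0" "(c, s) \<in> K"
      unfolding P_def by auto
    obtain c' s' where "(c', s') \<in> K" "h (z + - z) (l + 1) c' s' \<le> h z l c s + h (- z) 1 c0 s0"
      using comb[OF x(3) c0 x(2) zero_less_one] by blast
    then show "- h (- z) 1 c0 s0 \<le> (case x of (l, c, s) \<Rightarrow> h z l c s)"
      using h0[of c' s' "l + 1"] x by simp
  qed
  have lower: "q z \<le> h z l c s" if "(c, s) \<in> K" "l > 0" for z l c s
    using cINF_lower[OF bdd, of "(l, c, s)" z] that by (simp add: q_def P_def)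
  have greatest: "b \<le> q z" if "\<And>l c s. (c, s) \<in> K \<Longrightarrow> l > 0 \<Longrightarrow> b \<le> h z l c s" for b z
    unfolding q_def using P that by (intro cINF_greatest) (auto simp: P_def)
  have "sublinear q"
    unfolding sublinear_def
  proof (intro conjI allI impI)
    fix z z'
    have *: "q (z + z') \<le> h z l c s + h z' l' c' s'"
      if "(c, s) \<in> K" "l > 0" "(c', s') \<in> K" "l' > 0" for l c s l' c' s'
      using comb[OF that(1,3,2,4), of z z'] lower[of _ _ "l + l'" "z + z'"] that
      by (meson add_pos_pos order_trans)
    have "q (z + z') - h z' l' c' s' \<le> q z" if "(c', s') \<in> K" "l' > 0" for l' c' s'
      using *[OF _ _ that] by (intro greatest) (auto simp: algebra_simps)
    then have "q (z + z') - q z \<le> q z'"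
      by (intro greatest) (auto simp: algebra_simps)
    then show "q (z + z') \<le> q z + q z'" by simp
  next
    fix r :: real and z assume r: "r > 0"
    have "q (r *\<^sub>R z) / r \<le> q z"
    proof (rule greatest)
      fix l c s assume "(c, s) \<in> K" "(l::real) > 0"
      then show "q (r *\<^sub>R z) / r \<le> h z l c s"
        using lower[of c s "r * l" "r *\<^sub>R z"] r by (simp add: h_def field_simps)
    qed
    then show "q (r *\<^sub>R z) \<le> r * q z" using r by (simp add: field_simps)
  qed
  then obtain L where L: "linear L" "\<And>z. L z \<le> q z"
    by (rule Hahn_Banach_sublinear) blast
  have "e + L u - L c \<le> s + g u" if "(c, s) \<in> K" for u c s
    using L(2)[of "u - c"] lower[OF that, of 1 "u - c"] linear_diff[OF L(1), of u c]
    by (simp add: h_def)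
  then show ?thesis using L(1) by blast
qed

subsection \<open>Operators satisfying the negative infimum condition\<close>

lemma convex_on_norm_power2: "convex_on UNIV (\<lambda>u::'b::real_normed_vector. (norm u)\<^sup>2)"
proof (intro convex_onI)
  fix t :: real and x y :: 'b assume t: "0 < t" "t < 1"
  have "(norm ((1 - t) *\<^sub>R x + t *\<^sub>R y))\<^sup>2 \<le> ((1 - t) * norm x + t * norm y)\<^sup>2"
    using t norm_triangle_ineq[of "(1 - t) *\<^sub>R x" "t *\<^sub>R y"] by (intro power_mono) auto
  also have "\<dots> \<le> (1 - t) * (norm x)\<^sup>2 + t * (norm y)\<^sup>2"
    using convex_onD[OF convex_power2, of t "norm x" "norm y"] t by simp
  finally show "(norm ((1 - t) *\<^sub>R x + t *\<^sub>R y))\<^sup>2 \<le> (1 - t) * (norm x)\<^sup>2 + t * (norm y)\<^sup>2" .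
qed simp

lemma linear_quadratically_bounded_imp_bounded_linear:
  fixes f :: "'b::real_normed_vector \<Rightarrow> real"
  assumes f: "linear f" and le: "\<And>u. f u \<le> B + (norm u)\<^sup>2 / 2"
  shows "bounded_linear f"
proof -
  have B: "f u \<le> norm u * (B + 1 / 2)" for u
  proof (cases "u = 0")
    case False
    then show ?thesis
      using le[of "(1 / norm u) *\<^sub>R u"] linear_scale[OF f, of "1 / norm u" u]
      by (simp add: field_simps)
  qed (use linear_0[OF f] in simp)
  show ?thesis
    by (rule bounded_linear_intro[where K = "B + 1 / 2"])
      (use B[of x for x] B[of "- x" for x] linear_neg[OF f] linear_add[OF f] linear_scale[OF f]
        in \<open>auto simp: abs_le_iff\<close>)
qed

text \<open>This is one half of the fact that half the squared norm has half the squared dual norm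
  as its conjugate. The unit ball need not attain \<open>norm f\<close>, so the estimate is made on
  each line separately.\<close>

lemma le_neg_norm_power2_if_le_quadratic:
  fixes f :: "'b::real_normed_vector \<Rightarrow>\<^sub>L real"
  assumes "\<And>u. a \<le> f u + (norm u)\<^sup>2 / 2"
  shows "a \<le> - (norm f)\<^sup>2 / 2"
proof -
  have a: "a \<le> 0" using assms[of 0] by simp
  have "norm f \<le> sqrt (- 2 * a)"
  proof (rule norm_blinfun_bound)
    fix u
    show "norm (f u) \<le> sqrt (- 2 * a) * norm u"
    proof (cases "u = 0")
      case False
      then have n: "(norm u)\<^sup>2 > 0" by simp
      \<comment> \<open>The multiple \<open>- f u / (norm u)\<^sup>2\<close> of \<open>u\<close>
        minimises the quadratic on the line through \<open>u\<close>.\<close>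
      have "a \<le> - ((f u)\<^sup>2 / (norm u)\<^sup>2) + (\<bar>f u\<bar> / (norm u)\<^sup>2)\<^sup>2 * (norm u)\<^sup>2 / 2"
        using assms[of "(- f u / (norm u)\<^sup>2) *\<^sub>R u"] unfolding blinfun.scaleR_right
        by (simp add: power_mult_distrib power_divide) (simp add: power2_eq_square)
      also have "\<dots> = - ((f u)\<^sup>2 / (norm u)\<^sup>2 / 2)"
        using n by (simp add: power2_eq_square field_simps)
      finally have "(f u)\<^sup>2 \<le> (- 2 * a) * (norm u)\<^sup>2"
        using n by (simp add: field_simps)
      then have "sqrt ((f u)\<^sup>2) \<le> sqrt ((- 2 * a) * (norm u)\<^sup>2)"
        by (rule real_sqrt_le_mono)
      then show ?thesis unfolding real_sqrt_mult by simp
    qed simp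
  qed (use a in simp)
  then have "(norm f)\<^sup>2 \<le> (sqrt (- 2 * a))\<^sup>2"
    by (intro power_mono) auto
  then show ?thesis using a by simp
qed

lemma pairing_ge: "- (norm f * norm u) \<le> blinfun_apply (f :: 'b::real_normed_vector \<Rightarrow>\<^sub>L real) u"
  and pairing_le: "blinfun_apply (f :: 'b::real_normed_vector \<Rightarrow>\<^sub>L real) u \<le> norm f * norm u"
  using norm_blinfun[of f u] by (auto simp: abs_le_iff)

lemma neg_pairing_le:
  fixes f :: "'b::real_normed_vector \<Rightarrow>\<^sub>L real"
  shows "- f u \<le> (norm u)\<^sup>2 / 2 + (norm f)\<^sup>2 / 2"
proof -
  have "- f u \<le> norm u * norm f"
    using pairing_ge[of f u] by (simp add: mult.commute)
  also have "\<dots> \<le> (norm u)\<^sup>2 / 2 + (norm f)\<^sup>2 / 2"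
    using sum_squares_bound[of "norm u" "norm f"] by simp
  finally show ?thesis .
qed

text \<open>Working with graphs as sets lets translations and dual scalings act as plain
  images.\<close>

definition maximal_monotone_set :: "('a::real_normed_vector \<times> ('a \<Rightarrow>\<^sub>L real)) set \<Rightarrow> bool" where
  "maximal_monotone_set G \<longleftrightarrow>
     (\<forall>(x, x') \<in> G. \<forall>(y, y') \<in> G. blinfun_apply (x' - y') (x - y) \<ge> 0) \<and>
     (\<forall>x x'. (\<forall>(y, y') \<in> G. blinfun_apply (x' - y') (x - y) \<ge> 0) \<longrightarrow> (x, x') \<in> G)"

text \<open>Simons' negative infimum condition.\<close>

definition type_NI :: "('a::real_normed_vector \<times> ('a \<Rightarrow>\<^sub>L real)) set \<Rightarrow> bool" where
  "type_NI G \<longleftrightarrow> (\<forall>(xx :: ('a \<Rightarrow>\<^sub>L real) \<Rightarrow>\<^sub>L real) x'. \<forall>e>0.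
     \<exists>(y, y') \<in> G. blinfun_apply xx (x' - y') - blinfun_apply (x' - y') y \<le> e)"

text \<open>This is the e-enlargement of Burachik, Iusem and Svaiter; for \<open>e = 0\<close> and a
  maximal monotone \<open>G\<close> it is \<open>G\<close> itself.\<close>

definition enlargement ::
  "('a::real_normed_vector \<times> ('a \<Rightarrow>\<^sub>L real)) set \<Rightarrow> real \<Rightarrow> ('a \<times> ('a \<Rightarrow>\<^sub>L real)) set" where
  "enlargement G e = {(x, x'). \<forall>(y, y') \<in> G. blinfun_apply (x' - y') (x - y) \<ge> - e}"

text \<open>This gap is nonnegative and vanishes iff \<open>- x' \<in> J x\<close> for the duality mapping \<open>J\<close>.\<close>

definition duality_gap :: "'a::real_normed_vector \<Rightarrow> ('a \<Rightarrow>\<^sub>L real) \<Rightarrow> real" where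
  "duality_gap x x' = (norm x)\<^sup>2 / 2 + (norm x')\<^sup>2 / 2 + blinfun_apply x' x"

text \<open>The pairing becomes a real coordinate before the hull is taken; the lower boundary of
  the hull is then the largest convex function that stays below the pairing on
  \<open>G\<close>.\<close>

abbreviation paired_hull ::
  "('a::real_normed_vector \<times> ('a \<Rightarrow>\<^sub>L real)) set \<Rightarrow> (('a \<times> ('a \<Rightarrow>\<^sub>L real)) \<times> real) set" where
  "paired_hull G \<equiv> convex hull ((\<lambda>(y, y'). ((y, y'), blinfun_apply y' y)) ` G)"

lemma maximal_monotone_setD:
  assumes "maximal_monotone_set G"
  shows "(x, x') \<in> G \<Longrightarrow> (y, y') \<in> G \<Longrightarrow> blinfun_apply (x' - y') (x - y) \<ge> 0"
    and "(\<And>y y'. (y, y') \<in> G \<Longrightarrow> blinfun_apply (x' - y') (x - y) \<ge> 0) \<Longrightarrow> (x, x') \<in> G"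
  using assms unfolding maximal_monotone_set_def by (blast, blast)

text \<open>A positive lower bound over \<open>G\<close> would put \<open>(x, x')\<close> into
  \<open>G\<close>, where the value is 0. This is the Fitzpatrick inequality.\<close>

lemma maximal_monotone_set_ex_less:
  assumes "maximal_monotone_set G" "r > 0"
  obtains y y' where "(y, y') \<in> G" "blinfun_apply (x' - y') (x - y) < r"
proof (rule ccontr)
  assume "\<not> thesis"
  then have ge: "(y, y') \<in> G \<Longrightarrow> blinfun_apply (x' - y') (x - y) \<ge> r" for y y'
    using that[of y y'] by force
  have "(x, x') \<in> G"
    using order_trans[OF less_imp_le[OF assms(2)] ge]
    by (rule maximal_monotone_setD(2)[OF assms(1)])
  from ge[OF this] assms(2) show False by simp
qed

text \<open>Fenchel duality by contradiction: if the sum stays above \<open>e\<close>, the sandwich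
  theorem yields a functional on the product, whose components are up to sign an \<open>x'\<close>
  and a bidual \<open>xx\<close>. The negative infimum condition at this pair, with error
  \<open>e / 2\<close>, then contradicts the Fenchel--Young inequality.\<close>

lemma type_NI_paired_hull:
  fixes G :: "('a::real_normed_vector \<times> ('a \<Rightarrow>\<^sub>L real)) set"
  assumes NI: "type_NI G" and e: "e > 0"
  obtains c c' s where "((c, c'), s) \<in> paired_hull G"
    "s + (norm c)\<^sup>2 / 2 + (norm c')\<^sup>2 / 2 \<le> e"
proof (rule ccontr)
  assume neg: "\<not> thesis"
  define g :: "'a \<times> ('a \<Rightarrow>\<^sub>L real) \<Rightarrow> real"
    where "g = (\<lambda>(u, u'). (norm u)\<^sup>2 / 2 + (norm u')\<^sup>2 / 2)"
  have ge: "(c, s) \<in> paired_hull G \<Longrightarrow> e \<le> s + g c" for c s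
    using neg that[of "fst c" "snd c" s] unfolding g_def by (cases c) force
  have g: "convex_on UNIV g"
    unfolding convex_on_def
  proof (intro conjI ballI allI impI convex_UNIV)
    fix x y :: "'a \<times> ('a \<Rightarrow>\<^sub>L real)" and t r :: real assume tr: "0 \<le> t" "0 \<le> r" "t + r = 1"
    obtain a a' b b' where [simp]: "x = (a, a')" "y = (b, b')" by (cases x, cases y)
    have "(norm (t *\<^sub>R a + r *\<^sub>R b))\<^sup>2 \<le> t * (norm a)\<^sup>2 + r * (norm b)\<^sup>2"
      "(norm (t *\<^sub>R a' + r *\<^sub>R b'))\<^sup>2 \<le> t * (norm a')\<^sup>2 + r * (norm b')\<^sup>2"
      using convex_on_norm_power2 tr unfolding convex_on_def by blast+
    then show "g (t *\<^sub>R x + r *\<^sub>R y) \<le> t * g x + r * g y"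
      by (simp add: g_def field_simps)
  qed
  obtain y0 y0' where y0: "(y0, y0') \<in> G"
    using NI e unfolding type_NI_def by fastforce
  have inK: "((y, y'), blinfun_apply y' y) \<in> paired_hull G" if "(y, y') \<in> G" for y y'
    using that by (intro hull_inc) force
  have ne: "paired_hull G \<noteq> {}" using inK[OF y0] by blast
  obtain L where L: "linear L"
    and le: "\<And>u c s. (c, s) \<in> paired_hull G \<Longrightarrow> e + L u - L c \<le> s + g u"
    using convex_sandwich[OF convex_convex_hull ne g ge] by blast
  define f where "f = (\<lambda>u. - L (u, 0))"
  define f' where "f' = (\<lambda>u'. - L (0, u'))"
  have Lf: "L (u, u') = - f u - f' u'" for u u'
    using linear_add[OF L, of "(u, 0)" "(0, u')"] by (simp add: f_def f'_def)
  have lin: "linear f" "linear f'"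
    using linear_add[OF L, of "(u, 0)" "(w, 0)" for u w] linear_scale[OF L, of r "(u, 0)" for r u]
      linear_add[OF L, of "(0, u)" "(0, w)" for u w] linear_scale[OF L, of r "(0, u)" for r u]
    by (auto intro!: linearI simp: f_def f'_def)
  \<comment> \<open>One graph point in the sandwich bounds \<open>L\<close> by a constant plus
    \<open>g\<close>, which makes both components continuous.\<close>
  define B where "B = blinfun_apply y0' y0 - e + L (y0, y0')"
  have B: "L u \<le> B + g u" for u
    using le[OF inK[OF y0], of u] by (simp add: B_def)
  have f: "bounded_linear f" "bounded_linear f'"
    using B[of "(- u, 0)" for u] B[of "(0, - u)" for u] linear_neg[OF lin(1)] linear_neg[OF lin(2)]
    by (auto intro!: linear_quadratically_bounded_imp_bounded_linear[where B = B] lin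
        simp: Lf g_def linear_0[OF lin(1)] linear_0[OF lin(2)])
  define x' where "x' = Blinfun f"
  define xx where "xx = Blinfun f'"
  have app: "blinfun_apply x' = f" "blinfun_apply xx = f'"
    using f by (simp_all add: x'_def xx_def bounded_linear_Blinfun_apply)
  obtain y y' where y: "(y, y') \<in> G" "blinfun_apply xx (x' - y') - blinfun_apply (x' - y') y \<le> e / 2"
    using NI e unfolding type_NI_def by (metis (no_types, lifting) case_prodE half_gt_zero)
  have *: "xx x' + e / 2 \<le> xx u' + (norm u')\<^sup>2 / 2 + (x' u + (norm u)\<^sup>2 / 2)" for u u'
    using y(2) le[OF inK[OF y(1)], of "(u, u')"]
    by (simp add: g_def Lf app blinfun.diff_left blinfun.diff_right add_divide_distrib
        flip: app)
  have "xx x' + e / 2 - (xx u' + (norm u')\<^sup>2 / 2) \<le> - (norm x')\<^sup>2 / 2" for u'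
    using *[of u'] by (intro le_neg_norm_power2_if_le_quadratic) (simp add: algebra_simps)
  then have "xx x' + e / 2 + (norm x')\<^sup>2 / 2 \<le> - (norm xx)\<^sup>2 / 2"
    by (intro le_neg_norm_power2_if_le_quadratic) (simp add: algebra_simps)
  then show False
    using e neg_pairing_le[of xx x'] by (simp add: add_divide_distrib)
qed

text \<open>For fixed \<open>(y, y')\<close> the quantity in \<open>hull\<close> is affine in the
  hull point and nonnegative on the generators, hence on the hull. With
  \<open>maximal_monotone_set_ex_less\<close> this gives \<open>c' c \<le> s\<close> and so the gap
  bound; the Fenchel--Young inequality bounds \<open>s - c' c\<close> by \<open>e\<close>, which
  gives the enlargement.\<close>

lemma enlargement_duality_gap_0:
  assumes G: "maximal_monotone_set G" and NI: "type_NI G" and e: "e > 0"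
  obtains c c' where "(c, c') \<in> enlargement G e" "duality_gap c c' \<le> e"
proof -
  obtain c c' s where cs: "((c, c'), s) \<in> paired_hull G"
    and le: "s + (norm c)\<^sup>2 / 2 + (norm c')\<^sup>2 / 2 \<le> e"
    using type_NI_paired_hull[OF NI e] by blast
  have hull: "s - y' c - c' y + y' y \<ge> 0" if y: "(y, y') \<in> G" for y y'
  proof -
    define H where "H = {((c, c' :: 'a \<Rightarrow>\<^sub>L real), s). s - y' c - c' y + y' y \<ge> 0}"
    have "convex H"
    proof (rule convexI)
      fix p q and a b :: real assume pq: "p \<in> H" "q \<in> H" and ab: "0 \<le> a" "0 \<le> b" "a + b = 1"
      obtain p1 p2 p3 q1 q2 q3 where [simp]: "p = ((p1, p2), p3)" "q = ((q1, q2), q3)"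
        by (metis prod.exhaust)
      have "0 \<le> a * (p3 - y' p1 - p2 y + y' y) + b * (q3 - y' q1 - q2 y + y' y)"
        using pq ab by (auto simp: H_def)
      also have "\<dots> = (a * p3 + b * q3) - y' (a *\<^sub>R p1 + b *\<^sub>R q1)
          - blinfun_apply (a *\<^sub>R p2 + b *\<^sub>R q2) y + (a + b) * y' y"
        by (simp add: blinfun.bilinear_simps algebra_simps)
      finally show "a *\<^sub>R p + b *\<^sub>R q \<in> H"
        using ab by (simp add: H_def)
    qed
    moreover have "(\<lambda>(y, y'). ((y, y'), blinfun_apply y' y)) ` G \<subseteq> H"
      using maximal_monotone_setD(1)[OF G _ y]
      by (force simp: H_def blinfun.bilinear_simps algebra_simps)
    ultimately have "paired_hull G \<subseteq> H"
      by (intro hull_minimal)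
    then show ?thesis using cs by (auto simp: H_def)
  qed
  have mon: "blinfun_apply (c' - y') (c - y) \<ge> c' c - s" if "(y, y') \<in> G" for y y'
    using hull[OF that] by (simp add: blinfun.bilinear_simps)
  have "c' c \<le> s"
  proof (rule ccontr)
    assume "\<not> c' c \<le> s"
    then have "c' c - s > 0" by simp
    then obtain y y' where "(y, y') \<in> G" "blinfun_apply (c' - y') (c - y) < c' c - s"
      by (rule maximal_monotone_set_ex_less[OF G])
    then show False using mon by force
  qed
  then have "duality_gap c c' \<le> e"
    using le by (simp add: duality_gap_def)
  moreover have ge: "c' c - s \<ge> - e"
    using le neg_pairing_le[of c' c] by linarith
  have "(c, c') \<in> enlargement G e"
    using order_trans[OF ge mon] unfolding enlargement_def by auto
  ultimately show thesis using that by blast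
qed

lemma maximal_monotone_set_affine:
  assumes G: "maximal_monotone_set G" and l: "l > 0"
  shows "maximal_monotone_set ((\<lambda>(y, y'). (y - z, l *\<^sub>R (y' - z'))) ` G)"
  unfolding maximal_monotone_set_def
proof (intro conjI allI impI)
  show "\<forall>(x, x')\<in>(\<lambda>(y, y'). (y - z, l *\<^sub>R (y' - z'))) ` G.
      \<forall>(y, y')\<in>(\<lambda>(y, y'). (y - z, l *\<^sub>R (y' - z'))) ` G. 0 \<le> blinfun_apply (x' - y') (x - y)"
  proof clarsimp
    fix x x' y y' assume "(x, x') \<in> G" "(y, y') \<in> G"
    then have "0 \<le> l * blinfun_apply (x' - y') (x - y)"
      using maximal_monotone_setD(1)[OF G] l by auto
    then show "0 \<le> blinfun_apply (l *\<^sub>R (x' - z') - l *\<^sub>R (y' - z')) (x - y)"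
      by (simp add: blinfun.bilinear_simps algebra_simps)
  qed
next
  fix x x'
  assume ge: "\<forall>(y, y')\<in>(\<lambda>(y, y'). (y - z, l *\<^sub>R (y' - z'))) ` G. 0 \<le> blinfun_apply (x' - y') (x - y)"
  have "(x + z, (1 / l) *\<^sub>R x' + z') \<in> G"
  proof (rule maximal_monotone_setD(2)[OF G])
    fix y y' assume "(y, y') \<in> G"
    then have "0 \<le> blinfun_apply (x' - l *\<^sub>R (y' - z')) (x - (y - z)) / l"
      using ge l by auto
    also have "\<dots> = blinfun_apply ((1 / l) *\<^sub>R x' + z' - y') (x + z - y)"
      using l by (simp add: blinfun.bilinear_simps field_simps)
    finally show "0 \<le> blinfun_apply ((1 / l) *\<^sub>R x' + z' - y') (x + z - y)" .
  qed
  then show "(x, x') \<in> (\<lambda>(y, y'). (y - z, l *\<^sub>R (y' - z'))) ` G"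
    using l by (auto intro!: image_eqI[where x = "(x + z, (1 / l) *\<^sub>R x' + z')"])
qed

lemma type_NI_affine:
  assumes NI: "type_NI G" and l: "l > 0"
  shows "type_NI ((\<lambda>(y, y'). (y - z, l *\<^sub>R (y' - z'))) ` G)"
  unfolding type_NI_def
proof (intro allI impI)
  fix xx :: "('a \<Rightarrow>\<^sub>L real) \<Rightarrow>\<^sub>L real" and x' :: "'a \<Rightarrow>\<^sub>L real" and e :: real assume e: "e > 0"
  \<comment> \<open>Translating by \<open>z\<close> on the primal side adds the evaluation at
    \<open>z\<close> to the bidual element.\<close>
  define ev where "ev = Blinfun (\<lambda>f :: 'a \<Rightarrow>\<^sub>L real. f z)"
  have ev: "ev f = f z" for f
    unfolding ev_def by (simp add: bounded_linear_Blinfun_apply blinfun.bounded_linear_left)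
  define X' where "X' = (1 / l) *\<^sub>R x' + z'"
  have "\<exists>(y, y')\<in>G. blinfun_apply (xx + ev) (X' - y') - blinfun_apply (X' - y') y \<le> e / l"
    using NI e l unfolding type_NI_def by (meson divide_pos_pos)
  then obtain y y' where y: "(y, y') \<in> G"
    "blinfun_apply (xx + ev) (X' - y') - blinfun_apply (X' - y') y \<le> e / l"
    by auto
  have "xx (x' - l *\<^sub>R (y' - z')) - blinfun_apply (x' - l *\<^sub>R (y' - z')) (y - z)
     = l * (blinfun_apply (xx + ev) (X' - y') - blinfun_apply (X' - y') y)"
    using l by (simp add: X'_def ev blinfun.bilinear_simps algebra_simps)
  also have "\<dots> \<le> e"
    using y(2) l by (simp add: field_simps)
  finally show "\<exists>(y, y')\<in>(\<lambda>(y, y'). (y - z, l *\<^sub>R (y' - z'))) ` G.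
      xx (x' - y') - blinfun_apply (x' - y') y \<le> e"
    using y(1) by (intro bexI[OF _ imageI[OF y(1)]]) simp
qed

subsection \<open>The Bronsted--Rockafellar property and approximate resolvents\<close>

lemma geometric_steps_convergent:
  fixes X :: "nat \<Rightarrow> 'b::banach"
  assumes step: "\<And>n. norm (X (Suc n) - X n) \<le> C * (1 / 2) ^ n"
  obtains l where "X \<longlonglongrightarrow> l" "norm (l - X 0) \<le> 2 * C"
proof -
  have geo: "(\<lambda>n. C * (1 / 2) ^ n) sums (C * 2)"
    using sums_mult[OF geometric_sums[of "1 / 2 :: real"], of C] by simp
  have summ: "summable (\<lambda>n. X (Suc n) - X n)"
    by (rule summable_comparison_test'[OF sums_summable[OF geo] step])
  define l where "l = X 0 + (\<Sum>n. X (Suc n) - X n)"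
  have "(\<lambda>n. X 0 + (\<Sum>k<n. X (Suc k) - X k)) \<longlonglongrightarrow> l"
    unfolding l_def by (intro tendsto_intros summable_LIMSEQ summ)
  then have "X \<longlonglongrightarrow> l"
    by (simp add: sum_lessThan_telescope)
  moreover have "norm (\<Sum>n. X (Suc n) - X n) \<le> C * 2"
    using norm_sums_le[OF summable_sums[OF summ] geo step] .
  ultimately show thesis using that by (simp add: l_def mult.commute)
qed

lemma enlargement_duality_gap:
  assumes G: "maximal_monotone_set G" and NI: "type_NI G" and e: "e > 0"
  obtains c c' where "(c, c') \<in> enlargement G e" "duality_gap (c - z) (c' - z') \<le> e"
proof -
  define H where "H = (\<lambda>(y, y'). (y - z, 1 *\<^sub>R (y' - z'))) ` G"
  have "maximal_monotone_set H" "type_NI H"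
    unfolding H_def using maximal_monotone_set_affine[OF G] type_NI_affine[OF NI] zero_less_one by blast+
  then obtain c c' where c: "(c, c') \<in> enlargement H e" "duality_gap c c' \<le> e"
    using enlargement_duality_gap_0[OF _ _ e] by metis
  have "(c + z, c' + z') \<in> enlargement G e"
    using c(1) unfolding enlargement_def H_def by (auto simp: algebra_simps)
  then show thesis using that[of "c + z" "c' + z'"] c(2) by simp
qed

text \<open>At the midpoint of the two pairs the pairing is the mean of the two pairings minus a
  quarter of the cross term; \<open>maximal_monotone_set_ex_less\<close> forbids a positive lower
  bound there.\<close>

lemma enlargement_pairing_ge:
  assumes G: "maximal_monotone_set G"
    and z: "(z, z') \<in> enlargement G e" and c: "(c, c') \<in> enlargement G d"
  shows "blinfun_apply (c' - z') (c - z) \<ge> - 2 * (e + d)"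
proof (rule ccontr)
  define r where "r = - e / 2 - d / 2 - blinfun_apply (c' - z') (c - z) / 4"
  define m where "m = (1 / 2) *\<^sub>R (z + c)"
  define m' where "m' = (1 / 2) *\<^sub>R (z' + c')"
  assume "\<not> blinfun_apply (c' - z') (c - z) \<ge> - 2 * (e + d)"
  then have "r > 0" by (simp add: r_def field_simps)
  then obtain y y' where y: "(y, y') \<in> G" "blinfun_apply (m' - y') (m - y) < r"
    by (rule maximal_monotone_set_ex_less[OF G])
  have "blinfun_apply (m' - y') (m - y) = blinfun_apply (z' - y') (z - y) / 2
      + blinfun_apply (c' - y') (c - y) / 2 - blinfun_apply (c' - z') (c - z) / 4"
    by (simp add: m_def m'_def blinfun.bilinear_simps field_simps)
  moreover have "blinfun_apply (z' - y') (z - y) \<ge> - e" "blinfun_apply (c' - y') (c - y) \<ge> - d"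
    using z c y(1) unfolding enlargement_def by auto
  ultimately show False using y(2) unfolding r_def by simp
qed

text \<open>Centring the gap at \<open>(z, z')\<close> and inserting
  \<open>enlargement_pairing_ge\<close> bounds the sum of the squared distances by
  \<open>11 * e / 2\<close>, rounded up to \<open>9 * e\<close> for a clean root. The error drops by
  a factor 4, so the next step length halves.\<close>

lemma enlargement_step:
  assumes G: "maximal_monotone_set G" and NI: "type_NI G" and e: "e > 0"
    and z: "(z, z') \<in> enlargement G e"
  obtains c c' where "(c, c') \<in> enlargement G (e / 4)"
    "norm (c - z) \<le> 3 * sqrt e" "norm (c' - z') \<le> 3 * sqrt e"
proof -
  obtain c c' where c: "(c, c') \<in> enlargement G (e / 4)"
    and gap: "duality_gap (c - z) (c' - z') \<le> e / 4"
    using enlargement_duality_gap[OF G NI, of "e / 4"] e by (metis divide_pos_pos zero_less_numeral)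
  have sum: "(norm (c - z))\<^sup>2 + (norm (c' - z'))\<^sup>2 \<le> 9 * e"
    using enlargement_pairing_ge[OF G z c] gap e unfolding duality_gap_def by simp
  have "norm (c - z) \<le> sqrt (9 * e)" "norm (c' - z') \<le> sqrt (9 * e)"
    using sum zero_le_power2[of "norm (c - z)"] zero_le_power2[of "norm (c' - z')"]
    by (intro real_le_rsqrt; linarith)+
  then show thesis using that[OF c] by (simp add: real_sqrt_mult)
qed

lemma enlargement_tendsto_0:
  assumes G: "maximal_monotone_set G" and X: "\<And>n. (X n, X' n) \<in> enlargement G (e n)"
    and lim: "X \<longlonglongrightarrow> x" "X' \<longlonglongrightarrow> x'" "e \<longlonglongrightarrow> 0"
  shows "(x, x') \<in> G"
proof (rule maximal_monotone_setD(2)[OF G])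
  fix y y' assume y: "(y, y') \<in> G"
  have "(\<lambda>n. blinfun_apply (X' n - y') (X n - y)) \<longlonglongrightarrow> blinfun_apply (x' - y') (x - y)"
    by (intro tendsto_intros lim)
  moreover have "(\<lambda>n. - e n) \<longlonglongrightarrow> 0"
    using tendsto_minus[OF lim(3)] by simp
  moreover have "- e n \<le> blinfun_apply (X' n - y') (X n - y)" for n
    using X[of n] y unfolding enlargement_def by auto
  ultimately show "0 \<le> blinfun_apply (x' - y') (x - y)"
    by (intro LIMSEQ_le) auto
qed

text \<open>The step lengths form a geometric series with sum \<open>6 * sqrt e\<close>, and
  completeness gives a limit; as the errors \<open>e / 4 ^ n\<close> tend to 0, the limit lies in
  \<open>G\<close>.\<close>

lemma Bronsted_Rockafellar:
  fixes G :: "('a::banach \<times> ('a \<Rightarrow>\<^sub>L real)) set"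
  assumes G: "maximal_monotone_set G" and NI: "type_NI G" and e: "e > 0"
    and z: "(z, z') \<in> enlargement G e"
  obtains y y' where "(y, y') \<in> G" "norm (y - z) \<le> 6 * sqrt e" "norm (y' - z') \<le> 6 * sqrt e"
proof -
  \<comment> \<open>The clause for \<open>n = 0\<close> fixes the starting point, which the choice
    principle would otherwise leave open.\<close>
  define P where "P = (\<lambda>n p. p \<in> enlargement G (e / 4 ^ n) \<and> (n = 0 \<longrightarrow> p = (z, z')))"
  define Q where "Q = (\<lambda>n (p :: 'a \<times> ('a \<Rightarrow>\<^sub>L real)) q. norm (fst q - fst p) \<le> 3 * sqrt e * (1 / 2) ^ n
    \<and> norm (snd q - snd p) \<le> 3 * sqrt e * (1 / 2) ^ n)"
  have "\<exists>f. \<forall>n. P n (f n) \<and> Q n (f n) (f (Suc n))"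
  proof (rule dependent_nat_choice)
    show "\<exists>p. P 0 p" using z by (simp add: P_def)
    fix p n assume "P n p"
    then have p: "(fst p, snd p) \<in> enlargement G (e / 4 ^ n)" by (simp add: P_def)
    have en: "e / 4 ^ n > 0" using e by simp
    have sq: "sqrt (e / 4 ^ n) = sqrt e * (1 / 2) ^ n"
      by (simp add: real_sqrt_divide real_sqrt_power power_one_over field_simps)
    obtain c c' where "(c, c') \<in> enlargement G (e / 4 ^ n / 4)"
      "norm (c - fst p) \<le> 3 * sqrt (e / 4 ^ n)" "norm (c' - snd p) \<le> 3 * sqrt (e / 4 ^ n)"
      by (rule enlargement_step[OF G NI en p])
    then have "P (Suc n) (c, c') \<and> Q n p (c, c')"
      unfolding P_def Q_def sq by (simp add: mult.commute mult.left_commute)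
    then show "\<exists>q. P (Suc n) q \<and> Q n p q" ..
  qed
  then obtain f where f: "\<And>n. P n (f n)" "\<And>n. Q n (f n) (f (Suc n))" by blast
  have f0: "f 0 = (z, z')" using f(1)[of 0] by (simp add: P_def)
  obtain y where y: "(\<lambda>n. fst (f n)) \<longlonglongrightarrow> y" "norm (y - fst (f 0)) \<le> 2 * (3 * sqrt e)"
    by (rule geometric_steps_convergent[of "\<lambda>n. fst (f n)" "3 * sqrt e"])
      (use f(2) in \<open>auto simp: Q_def\<close>)
  obtain y' where y': "(\<lambda>n. snd (f n)) \<longlonglongrightarrow> y'" "norm (y' - snd (f 0)) \<le> 2 * (3 * sqrt e)"
    by (rule geometric_steps_convergent[of "\<lambda>n. snd (f n)" "3 * sqrt e"])
      (use f(2) in \<open>auto simp: Q_def\<close>)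
  have "(\<lambda>n. e / 4 ^ n) \<longlonglongrightarrow> 0"
    by (rule LIMSEQ_divide_realpow_zero) simp
  then have "(y, y') \<in> G"
    using f(1) unfolding P_def by (intro enlargement_tendsto_0[OF G _ y(1) y'(1)]) auto
  then show thesis using that y(2) y'(2) by (simp add: f0)
qed

lemma duality_gap_le_perturb:
  assumes "norm z \<le> M" "norm z' \<le> M" "norm y \<le> M" "norm y' \<le> M"
    and "norm (y - z) \<le> d" "norm (y' - z') \<le> d"
  shows "duality_gap y y' \<le> duality_gap z z' + 4 * M * d"
proof -
  have sq: "(norm u)\<^sup>2 - (norm w)\<^sup>2 \<le> 2 * M * d"
    if "norm u \<le> M" "norm w \<le> M" "norm (u - w) \<le> d" for u w :: "'b::real_normed_vector"
  proof -
    have "(norm u)\<^sup>2 - (norm w)\<^sup>2 = (norm u - norm w) * (norm u + norm w)"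
      by (simp add: power2_eq_square algebra_simps)
    also have "\<dots> \<le> d * (norm u + norm w)"
      using norm_triangle_ineq2[of u w] that by (intro mult_right_mono) auto
    also have "\<dots> \<le> d * (2 * M)"
      using that norm_ge_zero[of "u - w"] by (intro mult_left_mono) linarith+
    finally show ?thesis by (simp add: mult_ac)
  qed
  have "blinfun_apply y' y - blinfun_apply z' z = blinfun_apply (y' - z') y + blinfun_apply z' (y - z)"
    by (simp add: blinfun.bilinear_simps)
  also have "\<dots> \<le> norm (y' - z') * norm y + norm z' * norm (y - z)"
    by (intro add_mono pairing_le)
  also have "\<dots> \<le> d * M + M * d"
    using assms order_trans[OF norm_ge_zero assms(1)] order_trans[OF norm_ge_zero assms(5)]
    by (intro add_mono mult_mono) auto
  finally show ?thesis
    using sq[of y z] sq[of y' z'] assms unfolding duality_gap_def by (simp add: mult_ac)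
qed

text \<open>Monotonicity up to \<open>e\<close> against the fixed pair \<open>(x, x')\<close>
  replaces \<open>z' z\<close> by terms linear in the norms, and completing squares bounds these
  norms. The bound is independent of \<open>e\<close>, so it can be fixed before the error is
  chosen.\<close>

lemma enlargement_duality_gap_bounded:
  assumes x: "(x, x') \<in> G" and z: "(z, z') \<in> enlargement G e" "duality_gap z z' \<le> e"
    and e: "e \<le> 1"
  shows "norm z \<le> 2 * (norm x + norm x') + 2 \<and> norm z' \<le> 2 * (norm x + norm x') + 2"
proof -
  define a b R where "a = norm z" and "b = norm z'" and "R = norm x + norm x'"
  have nn: "a \<ge> 0" "b \<ge> 0" "R \<ge> 0" "norm x \<le> R" "norm x' \<le> R" by (auto simp: a_def b_def R_def)
  have "blinfun_apply (z' - x') (z - x) \<ge> - e"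
    using x z(1) unfolding enlargement_def by auto
  then have "a\<^sup>2 / 2 + b\<^sup>2 / 2 \<le> 2 * e + x' x - x' z - z' x"
    using z(2) by (simp add: duality_gap_def blinfun.bilinear_simps a_def b_def)
  also have "\<dots> \<le> 2 + norm x' * norm x + norm x' * a + norm x * b"
    using pairing_le[of x' x] pairing_ge[of x' z] pairing_ge[of z' x] e
    by (simp add: a_def b_def mult.commute)
  finally have "(a - norm x')\<^sup>2 + (b - norm x)\<^sup>2 \<le> 4 + (norm x + norm x')\<^sup>2"
    by (simp add: power2_eq_square algebra_simps)
  also have "\<dots> \<le> (R + 2)\<^sup>2"
    using nn by (simp add: R_def power2_eq_square algebra_simps)
  finally have *: "(a - norm x')\<^sup>2 + (b - norm x)\<^sup>2 \<le> (R + 2)\<^sup>2" .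
  have "a - norm x' \<le> R + 2"
    by (rule power2_le_imp_le) (use * nn zero_le_power2[of "b - norm x"] in linarith)+
  moreover have "b - norm x \<le> R + 2"
    by (rule power2_le_imp_le) (use * nn zero_le_power2[of "a - norm x'"] in linarith)+
  ultimately show ?thesis
    using nn unfolding a_def[symmetric] b_def[symmetric] R_def[symmetric] by linarith
qed

lemma graph_duality_gap_0:
  fixes G :: "('a::banach \<times> ('a \<Rightarrow>\<^sub>L real)) set"
  assumes G: "maximal_monotone_set G" and NI: "type_NI G" and e: "e > 0"
  obtains y y' where "(y, y') \<in> G" "duality_gap y y' \<le> e"
proof -
  obtain x x' where x: "(x, x') \<in> G"
    using NI e unfolding type_NI_def by fastforce
  \<comment> \<open>The norms of \<open>z\<close> and \<open>z'\<close> are at most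
    \<open>M - 6\<close>, which leaves room for a move of length
    \<open>6 * r \<le> 6\<close>.\<close>
  define M where "M = 2 * (norm x + norm x') + 8"
  have M: "M \<ge> 8" by (simp add: M_def)
  \<comment> \<open>The gap is at most \<open>r\<^sup>2 \<le> r\<close> in the enlargement and grows
    by at most \<open>4 * M * (6 * r)\<close> on moving into \<open>G\<close>.\<close>
  define r where "r = min 1 (e / (1 + 24 * M))"
  have r: "r > 0" "r \<le> 1" "r * (1 + 24 * M) \<le> e"
    using e M mult_right_mono[of r "e / (1 + 24 * M)" "1 + 24 * M"] by (auto simp: r_def)
  have r2: "r\<^sup>2 > 0" "r\<^sup>2 \<le> r" "sqrt (r\<^sup>2) = r"
    using r by (auto simp: power2_eq_square mult_left_le)
  obtain z z' where z: "(z, z') \<in> enlargement G (r\<^sup>2)" "duality_gap z z' \<le> r\<^sup>2"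
    by (rule enlargement_duality_gap_0[OF G NI r2(1)])
  obtain y y' where y: "(y, y') \<in> G" "norm (y - z) \<le> 6 * r" "norm (y' - z') \<le> 6 * r"
    using Bronsted_Rockafellar[OF G NI r2(1) z(1)] r2(3) by metis
  have zM: "norm z \<le> M - 6" "norm z' \<le> M - 6"
    using enlargement_duality_gap_bounded[OF x z] r r2 by (auto simp: M_def)
  have "duality_gap y y' \<le> duality_gap z z' + 4 * M * (6 * r)"
    using y zM r norm_triangle_sub[of y z] norm_triangle_sub[of y' z']
    by (intro duality_gap_le_perturb) auto
  also have "\<dots> \<le> r * (1 + 24 * M)"
    using z(2) r2(2) by (simp add: algebra_simps)
  finally show thesis using that[OF y(1)] r(3) by simp
qed

text \<open>An approximate resolvent: an exact zero of the left-hand side would be a solution of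
  \<open>0 \<in> l A y + J (y - z)\<close>.\<close>

lemma approximate_resolvent:
  fixes G :: "('a::banach \<times> ('a \<Rightarrow>\<^sub>L real)) set"
  assumes G: "maximal_monotone_set G" and NI: "type_NI G" and e: "e > 0" and l: "l > 0"
  obtains y y' where "(y, y') \<in> G"
    "l * (norm y')\<^sup>2 / 2 + (norm (y - z))\<^sup>2 / (2 * l) + y' (y - z) \<le> e"
proof -
  have le: "l * e > 0" using e l by simp
  obtain u u' where u: "(u, u') \<in> (\<lambda>(y, y'). (y - z, l *\<^sub>R (y' - 0))) ` G" "duality_gap u u' \<le> l * e"
    by (rule graph_duality_gap_0[OF maximal_monotone_set_affine[OF G l] type_NI_affine[OF NI l] le])
  then obtain y y' where y: "(y, y') \<in> G" "u = y - z" "u' = l *\<^sub>R y'" by auto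
  have "l * (l * (norm y')\<^sup>2 / 2 + (norm (y - z))\<^sup>2 / (2 * l) + y' (y - z)) = duality_gap u u'"
    using l by (simp add: duality_gap_def y(2,3) blinfun.scaleR_left power_mult_distrib
        power2_eq_square field_simps)
  then have "l * (l * (norm y')\<^sup>2 / 2 + (norm (y - z))\<^sup>2 / (2 * l) + y' (y - z)) \<le> l * e"
    using u(2) by simp
  then show thesis using that[OF y(1)] l by simp
qed

section \<open>From set-valued operators to graphs, and type (D)\<close>

lemma in_graph_iff: "(y, y') \<in> graph A \<longleftrightarrow> y' \<in> A y"
  by (simp add: graph_def)

lemma maximal_monotone_set_graph: "maximal_monotone A \<Longrightarrow> maximal_monotone_set (graph A)"
  by (simp only: maximal_monotone_def monotone_op_def maximal_monotone_set_def in_graph_iff)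

lemma maximal_monotoneD:
  assumes "maximal_monotone A" "x' \<in> A x" "y' \<in> A y"
  shows "blinfun_apply (x' - y') (x - y) \<ge> 0"
  using maximal_monotone_setD(1)[OF maximal_monotone_set_graph[OF assms(1)]] assms(2,3)
  by (simp add: in_graph_iff)

lemma maximal_monotoneI:
  assumes "maximal_monotone A" "\<And>y y'. y' \<in> A y \<Longrightarrow> blinfun_apply (x' - y') (x - y) \<ge> 0"
  shows "x' \<in> A x"
  using maximal_monotone_setD(2)[OF maximal_monotone_set_graph[OF assms(1)]] assms(2)
  unfolding in_graph_iff by blast

text \<open>If the condition fails at \<open>(xx, x')\<close>, this pair meets the premise of type
  (D). Along the resulting net \<open>x' - snd p\<close> tends to 0 in norm and \<open>fst p\<close>
  is bounded, so both pairings tend to 0, against the lower bound \<open>e\<close>.\<close>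

lemma type_D_imp_type_NI:
  assumes "type_D A"
  shows "type_NI (graph A)"
  unfolding type_NI_def
proof (intro allI impI, rule ccontr)
  fix xx :: "('a \<Rightarrow>\<^sub>L real) \<Rightarrow>\<^sub>L real" and x' :: "'a \<Rightarrow>\<^sub>L real" and e :: real
  assume e: "e > 0" and "\<not> (\<exists>(y, y')\<in>graph A. xx (x' - y') - blinfun_apply (x' - y') y \<le> e)"
  then have gt: "xx (x' - snd p) - blinfun_apply (x' - snd p) (fst p) > e" if "p \<in> graph A" for p
    using that by force
  then have "\<forall>(y, y')\<in>graph A. xx (x' - y') - blinfun_apply (x' - y') y \<ge> 0"
    using e by fastforce
  then obtain F B where F: "F \<noteq> bot" "eventually (\<lambda>p. p \<in> graph A) F"
    and B: "eventually (\<lambda>p. norm (fst p) \<le> B \<and> norm (snd p) \<le> B) F"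
    and lim: "((\<lambda>p. snd p) \<longlongrightarrow> x') F"
    using assms unfolding type_D_def by blast
  have 0: "((\<lambda>p. x' - snd p) \<longlongrightarrow> 0) F"
    using tendsto_diff[OF tendsto_const lim, of x'] by simp
  have "((\<lambda>p. blinfun_apply (x' - snd p) (fst p)) \<longlongrightarrow> 0) F"
  proof (rule Lim_null_comparison)
    show "\<forall>\<^sub>F p in F. norm (blinfun_apply (x' - snd p) (fst p)) \<le> norm (x' - snd p) * B"
      using B by eventually_elim (meson norm_blinfun mult_left_mono norm_ge_zero order_trans)
    show "((\<lambda>p. norm (x' - snd p) * B) \<longlongrightarrow> 0) F"
      using tendsto_mult_left_zero[OF tendsto_norm_zero[OF 0]] .
  qed
  moreover have "((\<lambda>p. xx (x' - snd p)) \<longlongrightarrow> xx 0) F"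
    by (intro tendsto_intros 0)
  ultimately have "((\<lambda>p. xx (x' - snd p) - blinfun_apply (x' - snd p) (fst p)) \<longlongrightarrow> 0) F"
    using tendsto_diff by fastforce
  moreover have "\<forall>\<^sub>F p in F. e \<le> xx (x' - snd p) - blinfun_apply (x' - snd p) (fst p)"
    using F(2) by eventually_elim (use gt in force)
  ultimately have "e \<le> 0"
    using F(1) tendsto_lowerbound by blast
  then show False using e by simp
qed

subsection \<open>Weak-star compactness\<close>

lemma compact_PiE_intervals: "compact (PiE UNIV (\<lambda>x::'b. {- c x .. c x :: real}))"
proof -
  have "compactin (product_topology (\<lambda>_. euclidean) UNIV) (PiE UNIV (\<lambda>x::'b. {- c x .. c x :: real}))"
    unfolding compactin_PiE by simp
  then show ?thesis by (simp add: euclidean_product_topology)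
qed

text \<open>The Banach--Alaoglu theorem, in terms of subnets.\<close>

lemma weak_star_cluster_point:
  fixes g :: "'i \<Rightarrow> 'a::real_normed_vector \<Rightarrow>\<^sub>L real"
  assumes F: "F \<noteq> bot" and M: "\<forall>\<^sub>F i in F. norm (g i) \<le> M"
  obtains f :: "'a \<Rightarrow>\<^sub>L real" and H
  where "H \<noteq> bot" "H \<le> F" "norm f \<le> M" "\<And>x. ((\<lambda>i. g i x) \<longlongrightarrow> f x) H"
proof -
  obtain i where "norm (g i) \<le> M" using eventually_happens'[OF F M] by blast
  then have M0: "M \<ge> 0" using norm_ge_zero order_trans by blast
  define K where "K = PiE UNIV (\<lambda>x::'a. {- (M * norm x) .. M * norm x})"
  have K: "compact K" unfolding K_def by (rule compact_PiE_intervals)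
  define e where "e = (\<lambda>i. blinfun_apply (g i))"
  have "\<forall>\<^sub>F h in filtermap e F. h \<in> K"
    unfolding eventually_filtermap using M
  proof eventually_elim
    case (elim i)
    have "\<bar>g i x\<bar> \<le> M * norm x" for x
      using norm_blinfun[of "g i" x] mult_right_mono[OF elim norm_ge_zero[of x]] by simp
    then show ?case by (auto simp: K_def e_def abs_le_iff minus_le_iff)
  qed
  moreover have "filtermap e F \<noteq> bot" using F by (simp add: filtermap_bot_iff)
  ultimately obtain \<phi> where \<phi>: "\<phi> \<in> K" "inf (nhds \<phi>) (filtermap e F) \<noteq> bot"
    using K unfolding compact_filter by blast
  \<comment> \<open>Adjoining to \<open>F\<close> the preimages of neighbourhoods of the cluster
    point is the filter form of passing to a subnet.\<close>
  define H where "H = inf F (filtercomap e (nhds \<phi>))"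
  have "H \<noteq> bot"
  proof
    assume "H = bot"
    then have "eventually (\<lambda>_. False) H" by simp
    then obtain Q S where Q: "eventually Q F" "eventually S (nhds \<phi>)" "\<And>i. Q i \<Longrightarrow> S (e i) \<Longrightarrow> False"
      unfolding H_def eventually_inf eventually_filtercomap by blast
    have "eventually (\<lambda>h. \<not> S h) (filtermap e F)"
      unfolding eventually_filtermap using Q(1) by eventually_elim (use Q(3) in blast)
    with Q(2) have "eventually (\<lambda>_. False) (inf (nhds \<phi>) (filtermap e F))"
      unfolding eventually_inf by blast
    then show False using \<phi>(2) by (simp add: eventually_False)
  qed
  have "filterlim e (nhds \<phi>) H"
    unfolding H_def filterlim_iff_le_filtercomap by simp
  then have lim: "((\<lambda>i. g i x) \<longlongrightarrow> \<phi> x) H" for x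
    using continuous_on_tendsto_compose[OF continuous_on_product_coordinates, of e \<phi> H x]
    by (simp add: e_def)
  have bd: "\<bar>\<phi> x\<bar> \<le> M * norm x" for x
    using \<phi>(1) by (auto simp: K_def abs_le_iff minus_le_iff PiE_iff)
  have "bounded_linear \<phi>"
  proof (rule bounded_linear_intro[where K = M])
    fix x y
    have "((\<lambda>i. g i (x + y)) \<longlongrightarrow> \<phi> x + \<phi> y) H"
      unfolding blinfun.add_right by (intro tendsto_add lim)
    then show "\<phi> (x + y) = \<phi> x + \<phi> y"
      using tendsto_unique[OF \<open>H \<noteq> bot\<close> lim] by blast
  next
    fix r x
    have "((\<lambda>i. g i (r *\<^sub>R x)) \<longlongrightarrow> r *\<^sub>R \<phi> x) H"
      unfolding blinfun.scaleR_right by (intro tendsto_scaleR tendsto_const lim)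
    then show "\<phi> (r *\<^sub>R x) = r *\<^sub>R \<phi> x"
      using tendsto_unique[OF \<open>H \<noteq> bot\<close> lim] by blast
  qed (use bd in \<open>simp add: mult.commute\<close>)
  then have app: "blinfun_apply (Blinfun \<phi>) = \<phi>"
    by (rule bounded_linear_Blinfun_apply)
  have "norm (Blinfun \<phi>) \<le> M"
    using M0 bd by (intro norm_blinfun_bound) (auto simp: app)
  moreover have "H \<le> F" by (simp add: H_def)
  ultimately show thesis
    using that[of H "Blinfun \<phi>"] \<open>H \<noteq> bot\<close> lim by (simp add: app)
qed

text \<open>Since \<open>g i\<close> is bounded and \<open>y i - x\<close> is norm-null, the pairing
  passes to the limit although \<open>g i\<close> converges only weak-star; maximality then puts
  \<open>f\<close> into \<open>A x\<close>.\<close>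

lemma maximal_monotone_cluster:
  fixes A :: "'a::real_normed_vector \<Rightarrow> ('a \<Rightarrow>\<^sub>L real) set" and g :: "'i \<Rightarrow> 'a \<Rightarrow>\<^sub>L real"
  assumes A: "maximal_monotone A" and F: "F \<noteq> bot"
    and gr: "\<forall>\<^sub>F i in F. g i \<in> A (y i)" and M: "\<forall>\<^sub>F i in F. norm (g i) \<le> M"
    and y: "(y \<longlongrightarrow> x) F"
  obtains f :: "'a \<Rightarrow>\<^sub>L real" and H
  where "H \<noteq> bot" "H \<le> F" "norm f \<le> M" "f \<in> A x" "\<And>u. ((\<lambda>i. g i u) \<longlongrightarrow> f u) H"
proof -
  obtain f :: "'a \<Rightarrow>\<^sub>L real" and H where H: "H \<noteq> bot" "H \<le> F" and f: "norm f \<le> M" "\<And>u. ((\<lambda>i. g i u) \<longlongrightarrow> f u) H"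
    using weak_star_cluster_point[OF F M] by metis
  have yH: "((\<lambda>i. y i - x) \<longlongrightarrow> 0) H"
    using tendsto_mono[OF H(2) y] by (simp add: LIM_zero)
  have MH: "\<forall>\<^sub>F i in H. norm (g i) \<le> M" and grH: "\<forall>\<^sub>F i in H. g i \<in> A (y i)"
    using M gr H(2) by (auto intro: filter_leD)
  have small: "((\<lambda>i. g i (y i - x)) \<longlongrightarrow> 0) H"
  proof (rule Lim_null_comparison)
    show "\<forall>\<^sub>F i in H. norm (g i (y i - x)) \<le> M * norm (y i - x)"
      using MH by eventually_elim (meson norm_blinfun mult_right_mono norm_ge_zero order_trans)
    show "((\<lambda>i. M * norm (y i - x)) \<longlongrightarrow> 0) H"
      by (rule tendsto_mult_right_zero[OF tendsto_norm_zero[OF yH]])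
  qed
  have "blinfun_apply (f - z') (x - z) \<ge> 0" if z: "z' \<in> A z" for z z'
  proof (rule tendsto_lowerbound[OF _ _ H(1)])
    have "((\<lambda>i. (g i (y i - x) + g i (x - z)) - z' ((y i - x) + (x - z)))
        \<longlongrightarrow> (0 + f (x - z)) - z' (0 + (x - z))) H"
      by (intro tendsto_intros small f(2) yH)
    then show "((\<lambda>i. blinfun_apply (g i - z') (y i - z)) \<longlongrightarrow> blinfun_apply (f - z') (x - z)) H"
      by (simp add: blinfun.diff_left flip: blinfun.add_right)
    show "\<forall>\<^sub>F i in H. 0 \<le> blinfun_apply (g i - z') (y i - z)"
      using grH by eventually_elim (rule maximal_monotoneD[OF A _ z])
  qed
  then have "f \<in> A x"
    by (rule maximal_monotoneI[OF A])
  then show thesis using that H f by blast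
qed

text \<open>A violating sequence has a weak-star cluster point in \<open>A x\<close> whose value at
  \<open>v\<close> is at least \<open>s\<close>. The bound \<open>M\<close> supplies the
  compactness, since \<open>A\<close> need not be locally bounded at \<open>x\<close>.\<close>

lemma support_fun_upper_semicontinuous:
  fixes A :: "'a::real_normed_vector \<Rightarrow> ('a \<Rightarrow>\<^sub>L real) set"
  assumes A: "maximal_monotone A" and s: "support_fun (A x) v < ereal s"
  obtains d where "d > 0"
    "\<And>y y'. norm (y - x) < d \<Longrightarrow> y' \<in> A y \<Longrightarrow> norm y' \<le> M \<Longrightarrow> blinfun_apply y' v \<le> s"
proof (rule ccontr)
  assume neg: "\<not> thesis"
  have "\<exists>y y'. norm (y - x) < inverse (real (Suc n)) \<and> y' \<in> A y \<and> norm y' \<le> M \<and> blinfun_apply y' v > s" for n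
    using neg that[of "inverse (real (Suc n))"] by force
  then obtain y y' where yn: "\<And>n. norm (y n - x) < inverse (real (Suc n))"
    and y': "\<And>n. y' n \<in> A (y n)" "\<And>n. norm (y' n) \<le> M" "\<And>n. blinfun_apply (y' n) v > s"
    by metis
  have "(\<lambda>n. y n - x) \<longlonglongrightarrow> 0"
    by (rule Lim_null_comparison[OF _ LIMSEQ_inverse_real_of_nat])
      (use yn less_imp_le in \<open>auto intro!: always_eventually\<close>)
  then have y: "y \<longlonglongrightarrow> x" by (simp add: LIM_zero_iff)
  obtain f :: "'a \<Rightarrow>\<^sub>L real" and H where H: "H \<noteq> bot" "f \<in> A x" "\<And>u. ((\<lambda>i. y' i u) \<longlongrightarrow> f u) H"
    by (rule maximal_monotone_cluster[OF A sequentially_bot _ _ y, of y' M])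
      (use y' in auto)
  have "s \<le> f v"
    by (rule tendsto_lowerbound[OF H(3) always_eventually H(1)]) (use y'(3) less_imp_le in blast)
  then have "ereal s \<le> support_fun (A x) v"
    unfolding support_fun_def using H(2) by (auto intro: SUP_upper2)
  then show False using s by simp
qed

section \<open>Elements of minimal norm\<close>

lemma maximal_monotone_convex:
  assumes A: "maximal_monotone A"
  shows "convex (A x)"
proof (rule convexI)
  fix f g and a b :: real assume fg: "f \<in> A x" "g \<in> A x" and ab: "0 \<le> a" "0 \<le> b" "a + b = 1"
  have "blinfun_apply (a *\<^sub>R f + b *\<^sub>R g - y') (x - y) \<ge> 0" if "y' \<in> A y" for y y'
  proof -
    have "blinfun_apply (f - y') (x - y) \<ge> 0" "blinfun_apply (g - y') (x - y) \<ge> 0"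
      using maximal_monotoneD[OF A] fg that by blast+
    then have "0 \<le> a * blinfun_apply (f - y') (x - y) + b * blinfun_apply (g - y') (x - y)"
      using ab by auto
    also have "\<dots> = blinfun_apply (a *\<^sub>R f + b *\<^sub>R g - (a + b) *\<^sub>R y') (x - y)"
      by (simp add: blinfun.diff_left blinfun.add_left blinfun.scaleR_left algebra_simps)
    finally show ?thesis using ab by simp
  qed
  then show "a *\<^sub>R f + b *\<^sub>R g \<in> A x"
    by (rule maximal_monotoneI[OF A])
qed

lemma strictly_convex_min_norm_unique:
  fixes C :: "'b::real_normed_vector set"
  assumes sc: "strictly_convex TYPE('b)" and C: "convex C"
    and f: "f \<in> C" "\<And>h. h \<in> C \<Longrightarrow> norm f \<le> norm h" and g: "g \<in> C" "\<And>h. h \<in> C \<Longrightarrow> norm g \<le> norm h"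
  shows "f = g"
proof (rule ccontr)
  assume ne: "f \<noteq> g"
  define m where "m = norm f"
  have m: "norm g = m" "norm f = m"
    using f g by (auto simp: m_def intro: antisym)
  have mpos: "m > 0" using ne m by (metis norm_eq_zero norm_ge_zero order_le_less)
  have "norm ((1 / 2) *\<^sub>R ((1 / m) *\<^sub>R f + (1 / m) *\<^sub>R g)) < 1"
    using sc ne m mpos unfolding strictly_convex_def by auto
  also have "(1 / 2) *\<^sub>R ((1 / m) *\<^sub>R f + (1 / m) *\<^sub>R g) = (1 / m) *\<^sub>R ((1 / 2) *\<^sub>R f + (1 / 2) *\<^sub>R g)"
    by (simp add: scaleR_add_right mult.commute)
  finally have "norm ((1 / 2) *\<^sub>R f + (1 / 2) *\<^sub>R g) < m"
    using mpos unfolding norm_scaleR by simp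
  moreover have "(1 / 2) *\<^sub>R f + (1 / 2) *\<^sub>R g \<in> C"
    using convexD[OF C f(1) g(1), of "1 / 2" "1 / 2"] by simp
  ultimately show False using f(2) m by force
qed

text \<open>A minimising sequence has a weak-star cluster point in \<open>A y\<close>, and the dual
  norm is weak-star lower semicontinuous. Uniqueness then makes the \<open>THE\<close> of the
  definition meaningful.\<close>

lemma min_norm_sel:
  fixes A :: "'a::real_normed_vector \<Rightarrow> ('a \<Rightarrow>\<^sub>L real) set"
  assumes sc: "strictly_convex TYPE('a \<Rightarrow>\<^sub>L real)" and A: "maximal_monotone A" and y: "y \<in> dom_op A"
  shows "min_norm_sel A y \<in> A y" and "\<And>g. g \<in> A y \<Longrightarrow> norm (min_norm_sel A y) \<le> norm g"
proof -
  define m where "m = Inf (norm ` A y)"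
  have ne: "norm ` A y \<noteq> {}" using y by (simp add: dom_op_def)
  have bdd: "bdd_below (norm ` A y)" by (rule bdd_belowI2[where m = 0]) simp
  have "\<exists>g. g \<in> A y \<and> norm g < m + inverse (real (Suc n))" for n
    using cInf_lessD[OF ne, of "m + inverse (real (Suc n))"] by (auto simp: m_def)
  then obtain g where g: "\<And>n. g n \<in> A y" "\<And>n. norm (g n) < m + inverse (real (Suc n))" by metis
  have "norm (g n) \<le> m + 1" for n
    using less_imp_le[OF g(2)[of n]] by (rule order_trans) (simp add: inverse_le_1_iff)
  then obtain f :: "'a \<Rightarrow>\<^sub>L real" and H where H: "H \<noteq> bot" "H \<le> sequentially" and f: "f \<in> A y" "\<And>u. ((\<lambda>i. g i u) \<longlongrightarrow> f u) H"
    using maximal_monotone_cluster[OF A sequentially_bot _ _ tendsto_const, of g y "m + 1"] g(1)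
    by (metis always_eventually)
  have lim: "((\<lambda>n. m + inverse (real (Suc n))) \<longlongrightarrow> m) H"
    using tendsto_mono[OF H(2) tendsto_add[OF tendsto_const LIMSEQ_inverse_real_of_nat, of m]] by simp
  have "norm (f u) \<le> m * norm u" for u
  proof (rule tendsto_le[OF H(1)])
    show "((\<lambda>n. (m + inverse (real (Suc n))) * norm u) \<longlongrightarrow> m * norm u) H"
      by (intro tendsto_mult lim tendsto_const)
    show "((\<lambda>n. norm (g n u)) \<longlongrightarrow> norm (f u)) H"
      by (intro tendsto_norm f(2))
    show "\<forall>\<^sub>F n in H. norm (g n u) \<le> (m + inverse (real (Suc n))) * norm u"
      using g(2) by (intro always_eventually allI)
        (meson less_imp_le mult_right_mono norm_blinfun norm_ge_zero order_trans)
  qed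
  moreover have "m \<ge> 0" unfolding m_def using ne by (intro cInf_greatest) auto
  ultimately have "norm f \<le> m" by (intro norm_blinfun_bound)
  then have min: "norm f \<le> norm h" if "h \<in> A y" for h
    using cInf_lower[OF imageI[OF that] bdd] unfolding m_def by linarith
  have "min_norm_sel A y = f"
    unfolding min_norm_sel_def
    by (rule the_equality)
      (use f(1) min strictly_convex_min_norm_unique[OF sc maximal_monotone_convex[OF A]] in blast)+
  then show "min_norm_sel A y \<in> A y" "\<And>g. g \<in> A y \<Longrightarrow> norm (min_norm_sel A y) \<le> norm g"
    using f(1) min by auto
qed

subsection \<open>The support function as a lower limit\<close>

lemma support_fun_le_Liminf:
  fixes A :: "'a::real_normed_vector \<Rightarrow> ('a \<Rightarrow>\<^sub>L real) set"
  assumes sc: "strictly_convex TYPE('a \<Rightarrow>\<^sub>L real)" and A: "maximal_monotone A"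
  shows "support_fun (A x) v \<le> Liminf (at_right (0::real) \<times>\<^sub>F nhds v) (\<lambda>(t, w). dir_val A x t w)"
  unfolding support_fun_def
proof (rule SUP_least)
  fix f assume f: "f \<in> A x"
  have ge: "ereal (f w) \<le> dir_val A x t w" if "t > 0" for t w
  proof (cases "x + t *\<^sub>R w \<in> dom_op A")
    case True
    define a where "a = min_norm_sel A (x + t *\<^sub>R w)"
    have "a \<in> A (x + t *\<^sub>R w)"
      unfolding a_def by (rule min_norm_sel(1)[OF sc A True])
    then have "blinfun_apply (a - f) ((x + t *\<^sub>R w) - x) \<ge> 0"
      using f by (rule maximal_monotoneD[OF A])
    then have "0 \<le> t * (a w - f w)"
      by (simp add: blinfun.diff_left blinfun.scaleR_right right_diff_distrib)
    then show ?thesis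
      using that True by (simp add: dir_val_def a_def zero_le_mult_iff)
  qed (simp add: dir_val_def)
  show "ereal (f v) \<le> Liminf (at_right 0 \<times>\<^sub>F nhds v) (\<lambda>(t, w). dir_val A x t w)"
    unfolding le_Liminf_iff
  proof (intro allI impI)
    fix y assume y: "y < ereal (f v)"
    have "((\<lambda>w. ereal (f w)) \<longlongrightarrow> ereal (f v)) (nhds v)"
      by (intro tendsto_intros filterlim_ident)
    then have "\<forall>\<^sub>F w in nhds v. y < ereal (f w)"
      using y by (rule order_tendstoD(1))
    moreover have "\<forall>\<^sub>F t in at_right (0::real). t > 0"
      by (rule eventually_at_right_less)
    ultimately show "\<forall>\<^sub>F p in at_right 0 \<times>\<^sub>F nhds v. y < (case p of (t, w) \<Rightarrow> dir_val A x t w)"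
      unfolding eventually_prod_filter
      by (intro exI conjI) (auto intro: less_le_trans[OF _ ge])
  qed
qed

section \<open>Near-optimal directions\<close>

lemma weighted_young:
  fixes p q a :: real
  assumes "a > 0"
  shows "p * q \<le> a * p\<^sup>2 + q\<^sup>2 / (4 * a)"
proof -
  have "0 \<le> (2 * a * p - q)\<^sup>2 / (4 * a)" using assms by simp
  also have "\<dots> = a * p\<^sup>2 + q\<^sup>2 / (4 * a) - p * q"
    using assms by (simp add: power2_eq_square field_simps)
  finally show ?thesis by simp
qed

text \<open>The resolvent is taken with parameter \<open>a * t\<close> and error
  \<open>e * t\<close>, so that dividing by \<open>t\<close> leaves constants free of
  \<open>t\<close>. Monotonicity against \<open>f\<close> bounds \<open>y' d\<close> below by
  \<open>f v + f d - y' v\<close>, and \<open>f d\<close> is absorbed by half of the quadratic term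
  in \<open>norm d\<close> and one more \<open>e\<close>.\<close>

lemma approximate_direction:
  fixes A :: "'a::banach \<Rightarrow> ('a \<Rightarrow>\<^sub>L real) set"
  assumes A: "maximal_monotone A" "type_D A" and f: "f \<in> A x"
    and pos: "e > 0" "a > 0" "t > 0" and a: "a * (norm f)\<^sup>2 \<le> e"
  obtains w and y' :: "'a \<Rightarrow>\<^sub>L real" where "y' \<in> A (x + t *\<^sub>R w)"
    "a * (norm y')\<^sup>2 / 2 + (norm (w - v))\<^sup>2 / (4 * a) \<le> 2 * e + y' v - f v"
proof -
  have at: "a * t > 0" and et: "e * t > 0" using pos by auto
  obtain y and y' :: "'a \<Rightarrow>\<^sub>L real" where y: "(y, y') \<in> graph A"
    and le: "a * t * (norm y')\<^sup>2 / 2 + (norm (y - (x + t *\<^sub>R v)))\<^sup>2 / (2 * (a * t))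
      + y' (y - (x + t *\<^sub>R v)) \<le> e * t"
    by (rule approximate_resolvent[OF maximal_monotone_set_graph[OF A(1)] type_D_imp_type_NI[OF A(2)] et at])
  define w where "w = (1 / t) *\<^sub>R (y - x)"
  define d where "d = w - v"
  have yw: "y = x + t *\<^sub>R w" "w = v + d" using pos by (simp_all add: w_def d_def)
  have yd: "y - (x + t *\<^sub>R v) = t *\<^sub>R d" by (simp add: yw scaleR_add_right)
  have "t * (a * (norm y')\<^sup>2 / 2 + (norm d)\<^sup>2 / (2 * a) + y' d) \<le> t * e"
    using le pos unfolding yd
    by (simp add: blinfun.scaleR_right power_mult_distrib power2_eq_square field_simps)
  then have *: "a * (norm y')\<^sup>2 / 2 + (norm d)\<^sup>2 / (2 * a) + y' d \<le> e"
    using pos by simp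
  have y': "y' \<in> A (x + t *\<^sub>R w)" using y by (simp add: in_graph_iff yw(1))
  then have "blinfun_apply (y' - f) ((x + t *\<^sub>R w) - x) \<ge> 0"
    using f by (rule maximal_monotoneD[OF A(1)])
  then have "0 \<le> t * (y' w - f w)"
    by (simp add: blinfun.diff_left blinfun.scaleR_right right_diff_distrib)
  then have "f v + f d \<le> y' v + y' d"
    using pos by (simp add: zero_le_mult_iff yw(2) blinfun.add_right)
  moreover have "- f d \<le> a * (norm f)\<^sup>2 + (norm d)\<^sup>2 / (4 * a)"
    using weighted_young[OF pos(2), of "norm f" "norm d"] pairing_ge[of f d] by linarith
  moreover have "(norm d)\<^sup>2 / (2 * a) = (norm d)\<^sup>2 / (4 * a) + (norm d)\<^sup>2 / (4 * a)"
    by simp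
  ultimately have "a * (norm y')\<^sup>2 / 2 + (norm d)\<^sup>2 / (4 * a) \<le> 2 * e + y' v - f v"
    using * a by linarith
  then show thesis using that[OF y'] by (simp add: d_def)
qed

text \<open>The estimate of \<open>approximate_direction\<close> is used twice. With a crude bound
  for \<open>y' v\<close> it bounds \<open>norm y'\<close> and \<open>norm (w - v)\<close>
  independently of \<open>t\<close>; for \<open>t\<close> small enough semicontinuity gives
  \<open>y' v \<le> s + e\<close>, and the estimate becomes small.\<close>

lemma ex_direction_near:
  fixes A :: "'a::banach \<Rightarrow> ('a \<Rightarrow>\<^sub>L real) set"
  assumes sc: "strictly_convex TYPE('a \<Rightarrow>\<^sub>L real)" and A: "maximal_monotone A" "type_D A"
    and s: "support_fun (A x) v = ereal s" and e: "e > 0" and d: "d > 0"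
  obtains t w where "0 < t" "t < d" "norm (w - v) < d" "dir_val A x t w \<le> ereal (s + 9 * e)"
proof -
  have "ereal (s - e) < (SUP f\<in>A x. ereal (blinfun_apply f v))"
    using s e by (simp add: support_fun_def)
  then obtain f where f: "f \<in> A x" "s - e < f v"
    unfolding less_SUP_iff by auto
  \<comment> \<open>The first entry keeps \<open>a * (norm f)\<^sup>2\<close> below
    \<open>e\<close>; the second turns the later bound \<open>q\<^sup>2 \<le> 16 * a * e\<close>
    into \<open>q < d\<close>.\<close>
  define a where "a = min (e / ((norm f)\<^sup>2 + 1)) (d\<^sup>2 / (32 * e))"
  have a: "a > 0" using e d by (simp add: a_def add_nonneg_pos)
  have af: "a * (norm f)\<^sup>2 \<le> e"
  proof -
    have "a * (norm f)\<^sup>2 \<le> a * ((norm f)\<^sup>2 + 1)" using a by simp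
    also have "\<dots> \<le> e / ((norm f)\<^sup>2 + 1) * ((norm f)\<^sup>2 + 1)"
      by (intro mult_right_mono) (simp_all add: a_def)
    also have "\<dots> = e" using add_nonneg_pos[OF zero_le_power2[of "norm f"] zero_less_one] by simp
    finally show ?thesis .
  qed
  have ad: "16 * a * e < d\<^sup>2"
  proof -
    have "16 * a * e \<le> 16 * (d\<^sup>2 / (32 * e)) * e"
      using e by (intro mult_right_mono mult_left_mono) (auto simp: a_def)
    also have "\<dots> < d\<^sup>2" using e d by simp
    finally show ?thesis .
  qed
  define C where "C = 2 * e + (norm v)\<^sup>2 / a + \<bar>f v\<bar>"
  define M where "M = sqrt (4 * C / a)"
  define N where "N = sqrt (4 * C * a)"
  have s': "support_fun (A x) v < ereal (s + e)" using s e by simp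
  obtain r where r: "r > 0"
    and usc: "\<And>y y'. norm (y - x) < r \<Longrightarrow> y' \<in> A y \<Longrightarrow> norm y' \<le> M \<Longrightarrow> blinfun_apply y' v \<le> s + e"
    using support_fun_upper_semicontinuous[OF A(1) s', of M] by metis
  \<comment> \<open>\<open>D\<close> will bound \<open>norm w\<close> through
    \<open>q \<le> N\<close>, so \<open>t * D < r\<close> puts \<open>x + t *\<^sub>R w\<close> into
    the ball where semicontinuity applies.\<close>
  define D where "D = norm v + \<bar>N\<bar> + 1"
  have D: "D > 0" unfolding D_def using norm_ge_zero[of v] abs_ge_zero[of N] by linarith
  define t where "t = min (d / 2) (r / D / 2)"
  have t: "t > 0" "t < d" using d r D by (auto simp: t_def)
  have tr: "t * D < r"
  proof -
    have "t * D \<le> r / D / 2 * D"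
      using D by (intro mult_right_mono) (auto simp: t_def)
    also have "\<dots> < r" using r D by simp
    finally show ?thesis .
  qed
  obtain w and y' :: "'a \<Rightarrow>\<^sub>L real" where y': "y' \<in> A (x + t *\<^sub>R w)"
    and le: "a * (norm y')\<^sup>2 / 2 + (norm (w - v))\<^sup>2 / (4 * a) \<le> 2 * e + y' v - f v"
    by (rule approximate_direction[OF A f(1) e a t(1) af])
  define p q where "p = norm y'" and "q = norm (w - v)"
  note le = le[folded p_def q_def]
  \<comment> \<open>The weight \<open>a / 4\<close> lets half of the term
    \<open>a * p\<^sup>2 / 2\<close> absorb \<open>y' v\<close>.\<close>
  have "y' v \<le> (a / 4) * p\<^sup>2 + (norm v)\<^sup>2 / (4 * (a / 4))"
    using pairing_le[of y' v] weighted_young[of "a / 4" p "norm v"] a unfolding p_def by linarith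
  then have "y' v \<le> a * p\<^sup>2 / 4 + (norm v)\<^sup>2 / a" by simp
  moreover have "- f v \<le> \<bar>f v\<bar>" by simp
  moreover have "a * p\<^sup>2 / 2 = a * p\<^sup>2 / 4 + a * p\<^sup>2 / 4" by simp
  ultimately have C: "a * p\<^sup>2 / 4 + q\<^sup>2 / (4 * a) \<le> C"
    using le unfolding C_def by linarith
  have nn: "a * p\<^sup>2 \<ge> 0" "q\<^sup>2 / (4 * a) \<ge> 0" "p \<ge> 0" "q \<ge> 0"
    using a by (auto simp: p_def q_def)
  have pM: "p \<le> M"
    unfolding M_def
  proof (rule real_le_rsqrt)
    have "a * p\<^sup>2 \<le> 4 * C" using C nn(2) by linarith
    then show "p\<^sup>2 \<le> 4 * C / a" using a by (simp add: field_simps)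
  qed
  have qN: "q \<le> N"
    unfolding N_def
  proof (rule real_le_rsqrt)
    have "q\<^sup>2 / (4 * a) \<le> C" using C nn(1) by linarith
    then show "q\<^sup>2 \<le> 4 * C * a" using a by (simp add: field_simps)
  qed
  have "norm w \<le> norm v + q"
    unfolding q_def by (metis add.commute norm_triangle_sub)
  then have "norm ((x + t *\<^sub>R w) - x) \<le> t * D"
    using t(1) qN by (simp add: D_def)
  then have near: "norm ((x + t *\<^sub>R w) - x) < r" using tr by linarith
  define b where "b = min_norm_sel A (x + t *\<^sub>R w)"
  have dom: "x + t *\<^sub>R w \<in> dom_op A" using y' by (auto simp: dom_op_def)
  have b: "b \<in> A (x + t *\<^sub>R w)" "norm b \<le> p"
    unfolding b_def p_def using min_norm_sel[OF sc A(1) dom] y' by auto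
  have "y' v \<le> s + e" using usc[OF near y'] pM by (simp add: p_def)
  then have small: "a * p\<^sup>2 / 2 + q\<^sup>2 / (4 * a) \<le> 4 * e"
    using le f(2) by linarith
  have "q\<^sup>2 / (4 * a) \<le> 4 * e" using small nn(1) by linarith
  then have "q\<^sup>2 \<le> 16 * a * e" using a by (simp add: field_simps)
  then have "q < d" using ad d power_less_imp_less_base[of q 2 d] by simp
  have "p * q \<le> 8 * e"
  proof -
    have "p * q \<le> a * p\<^sup>2 + q\<^sup>2 / (4 * a)" by (rule weighted_young[OF a])
    then show ?thesis using small nn(2) by simp
  qed
  \<comment> \<open>As \<open>norm b \<le> p \<le> M\<close>, the semicontinuity bound covers the
    minimal element as well; its \<open>e\<close> and the \<open>8 * e\<close> from
    \<open>p * q\<close> make up the constant 9.\<close>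
  moreover have "b v \<le> s + e" using usc[OF near b(1)] b(2) pM by simp
  moreover have "b (w - v) \<le> p * q"
    using pairing_le[of b "w - v"] mult_right_mono[OF b(2) nn(4)] unfolding q_def by linarith
  ultimately have "b w \<le> s + 9 * e" by (simp add: blinfun.diff_right)
  then have "dir_val A x t w \<le> ereal (s + 9 * e)"
    using dom by (simp add: dir_val_def b_def)
  then show thesis using that t \<open>q < d\<close> by (simp add: q_def)
qed

theorem theorem4p2:
  fixes A :: "'a::banach \<Rightarrow> ('a \<Rightarrow>\<^sub>L real) set"
  assumes "strictly_convex TYPE('a \<Rightarrow>\<^sub>L real)"
    and "strictly_convex TYPE(('a \<Rightarrow>\<^sub>L real) \<Rightarrow>\<^sub>L real)"
    and "w_Kadec_Klee TYPE('a)"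
    and "wstar_Kadec_Klee TYPE('a)"
    and "maximal_monotone A"
    and "type_D A"
    and "x \<in> dom_op A"
    and "v \<noteq> 0"
  shows "support_fun (A x) v =
           Liminf (at_right (0::real) \<times>\<^sub>F nhds v) (\<lambda>(t, w). dir_val A x t w)"
proof (rule antisym)
  let ?L = "Liminf (at_right (0::real) \<times>\<^sub>F nhds v) (\<lambda>(t, w). dir_val A x t w)"
  show "support_fun (A x) v \<le> ?L"
    using assms(1,5) by (rule support_fun_le_Liminf)
  show "?L \<le> support_fun (A x) v"
  proof (rule ccontr)
    assume "\<not> ?L \<le> support_fun (A x) v"
    then obtain z where z: "support_fun (A x) v < ereal z" "ereal z < ?L"
      using ereal_dense2 by (metis not_le)
    obtain f :: "'a \<Rightarrow>\<^sub>L real" where "f \<in> A x" using assms(7) by (auto simp: dom_op_def)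
    then have "ereal (f v) \<le> support_fun (A x) v"
      unfolding support_fun_def by (rule SUP_upper)
    with z(1) obtain s where s: "support_fun (A x) v = ereal s"
      by (cases "support_fun (A x) v") auto
    \<comment> \<open>The error is fitted so that \<open>s + 9 * e\<close>, the value reached by
      \<open>ex_direction_near\<close>, is exactly \<open>z\<close>.\<close>
    define e where "e = (z - s) / 9"
    have e: "e > 0" "s + 9 * e = z" using z(1) s by (auto simp: e_def diff_divide_distrib)
    obtain P Q where P: "eventually P (at_right (0::real))" "eventually Q (nhds v)"
      "\<And>t w. P t \<Longrightarrow> Q w \<Longrightarrow> ereal z < dir_val A x t w"
      using less_LiminfD[OF z(2)] unfolding eventually_prod_filter by auto
    obtain d1 where d1: "d1 > 0" "\<And>t. 0 < t \<Longrightarrow> t < d1 \<Longrightarrow> P t"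
      using P(1) unfolding eventually_at_right_field by auto
    obtain d2 where d2: "d2 > 0" "\<And>w. norm (w - v) < d2 \<Longrightarrow> Q w"
      using P(2) unfolding eventually_nhds_metric dist_norm by auto
    have "min d1 d2 > 0" using d1 d2 by simp
    then obtain t w where "0 < t" "t < min d1 d2" "norm (w - v) < min d1 d2"
      "dir_val A x t w \<le> ereal (s + 9 * e)"
      by (rule ex_direction_near[OF assms(1,5,6) s e(1)])
    then show False using P(3)[of t w] d1(2) d2(2) e(2) by auto
  qed
qed

end
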